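(* Let $D\subseteq\mathbb R$ be a domain, let $m\ge 2$ be an integer, and let $J\in C^m(D;\mathbb R)$ satisfy the following: there exist $x^*\in D$ and $J^*\in\mathbb R$ such that $J'(x)=0$ if and only if $x=x^*$, $J(x^* )=J^*$, $J(x)>J^*$ for all $x\in D\setminus\{x^*\}$, and there exist positive constants $\alpha_1,\alpha_2,\beta_1,\beta_2$ such that for all $x\in D$ $$\alpha_1|x-x^*|^m\le J(x)-J^*\le\alpha_2|x-x^*|^m,\qquad J^{(m-1)}(x)(x-x^* )\ge\beta_1|x-x^*|^2,\qquad |J^{(m-1)}(x)|\le\beta_2|x-x^*|.$$ Let $N=m-1$. Let $g_1,g_2:\mathbb R\to\mathbb R$ be such that $f_k:=g_k\circ J\in C^m(D;\mathbb R)$, $k=1,2$, and, for some $\sigma>0$, $$\big(\mathrm{ad}_{f_1}^N f_2\big)(x)=-\sigma J^{(N)}(x)\quad\text{for all }x\in D.$$ Let $\kappa\in\mathbb N$, $\kappa\ge1$, let $c_1,c_2\in\mathbb R$ satisfy $c_1^Nc_2=(4\pi\kappa)^N N!\,(-1)^{\lfloor N/2\rfloor}$, and for $\varepsilon>0$ let $$u_1^\varepsilon(t)=\varepsilon^{-\frac{N}{N+1}}c_1\cos\Big(\frac{2\kappa\pi t}{\varepsilon}\Big),\qquad u_2^\varepsilon(t)=\begin{cases}\varepsilon^{-\frac{N}{N+1}}c_2\sin\Big(\dfrac{2N\kappa\pi t}{\varepsilon}\Big), & N\text{ odd},\\[2mm] \varepsilon^{-\frac{N}{N+1}}c_2\cos\Big(\dfrac{2N\kappa\pi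 t}{\varepsilon}\Big), & N\text{ even}.\end{cases}$$ Then $x^*$ is semi-globally practically exponentially stable for the system $$\dot x=g_1(J(x))\,u_1^\varepsilon(t)+g_2(J(x))\,u_2^\varepsilon(t).$$ Namely, for any $\delta>0$ such that $\overline{B_\delta(x^* )}\subset D$, any $\bar\gamma\in(0,\sigma\beta_1)$, and any $\rho\in(0,\delta)$, there exists $\bar\varepsilon>0$ such that for any $\varepsilon\in(0,\bar\varepsilon]$ and any $\gamma\in(0,\bar\gamma]$ there is a constant $\lambda>0$ such that, for every $x^0\in B_\delta(x^* )$, the solution of the system with $x(0)=x^0$ is defined for all $t\ge0$ and satisfies $$|x(t)-x^*|\le\lambda\,|x^0-x^*|\,e^{-\gamma t}+\rho\quad\text{for all }t\ge0.$$
   Context: For sufficiently smooth $f,g:D\to\mathbb R$ with $D\subseteq\mathbb R$ open (regarded as vector fields on $D$), the Lie bracket is $[f,g](x)=g'(x)f(x)-f'(x)g(x)$, and $\mathrm{ad}_{f_1}^N f_2=[\underbrace{f_1,[f_1,\dots,[f_1}_{N\text{ times}},f_2]\dots]]$. $J^{(\ell)}$ denotes the $\ell$-th derivative of $J$. $B_\delta(x^* )$ is the $\delta$-neighborhood of $x^*$ and $\overline{B_\delta(x^* )}$ its closure. $\lfloor\cdot\rfloor$ denotes the integer part. *)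

theory Defs
  imports "HOL-Analysis.Analysis"
begin

text \<open>
  \<open>C_on k f D\<close> is meant for open \<open>D\<close>: then \<open>(deriv ^^ i) f\<close> restricted to \<open>D\<close> depends only on
  \<open>f\<close> restricted to \<open>D\<close>, and is the classical \<open>i\<close>-th derivative for \<open>i \<le> k\<close>.
\<close>

definition C_on :: "nat \<Rightarrow> (real \<Rightarrow> real) \<Rightarrow> real set \<Rightarrow> bool" where
  "C_on k f D \<longleftrightarrow>
     (\<forall>i<k. \<forall>x\<in>D. ((deriv ^^ i) f) differentiable (at x)) \<and>
     continuous_on D ((deriv ^^ k) f)"

definition lie_bracket :: "(real \<Rightarrow> real) \<Rightarrow> (real \<Rightarrow> real) \<Rightarrow> real \<Rightarrow> real" where
  "lie_bracket f g = (\<lambda>x. deriv g x * f x - deriv f x * g x)"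

definition ad_pow :: "(real \<Rightarrow> real) \<Rightarrow> nat \<Rightarrow> (real \<Rightarrow> real) \<Rightarrow> real \<Rightarrow> real" where
  "ad_pow f N = lie_bracket f ^^ N"

definition dither1 :: "nat \<Rightarrow> nat \<Rightarrow> real \<Rightarrow> real \<Rightarrow> real \<Rightarrow> real" where
  "dither1 N \<kappa> c1 \<epsilon> t =
     \<epsilon> powr (- (real N / (real N + 1))) * c1 * cos (2 * real \<kappa> * pi * t / \<epsilon>)"

definition dither2 :: "nat \<Rightarrow> nat \<Rightarrow> real \<Rightarrow> real \<Rightarrow> real \<Rightarrow> real" where
  "dither2 N \<kappa> c2 \<epsilon> t =
     \<epsilon> powr (- (real N / (real N + 1))) * c2 *
       (if odd N then sin (2 * real N * real \<kappa> * pi * t / \<epsilon>)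
        else cos (2 * real N * real \<kappa> * pi * t / \<epsilon>))"

text \<open>
  Classical solutions of \<open>x' = F t x\<close> on the time set \<open>I\<close> with values in \<open>D\<close>; at an endpoint of
  \<open>I\<close> the derivative is one-sided.
\<close>

definition ode_solution_on ::
  "real set \<Rightarrow> (real \<Rightarrow> real \<Rightarrow> real) \<Rightarrow> real set \<Rightarrow> (real \<Rightarrow> real) \<Rightarrow> bool" where
  "ode_solution_on D F I x \<longleftrightarrow>
     (\<forall>t\<in>I. x t \<in> D \<and> (x has_real_derivative F t (x t)) (at t within I))"

text \<open>
  The solution of the initial value problem \<open>x' = F t x\<close>, \<open>x 0 = x0\<close> is defined for all \<open>t \<ge> 0\<close>
  and equals \<open>x\<close> there: every solution on an initial interval is a restriction of \<open>x\<close>.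
  The values \<open>x t\<close> for \<open>t < 0\<close> are irrelevant.
\<close>

definition is_global_solution ::
  "real set \<Rightarrow> (real \<Rightarrow> real \<Rightarrow> real) \<Rightarrow> real \<Rightarrow> (real \<Rightarrow> real) \<Rightarrow> bool" where
  "is_global_solution D F x0 x \<longleftrightarrow>
     ode_solution_on D F {0..} x \<and> x 0 = x0 \<and>
     (\<forall>T>0. \<forall>y. ode_solution_on D F {0..<T} y \<and> y 0 = x0 \<longrightarrow> (\<forall>t\<in>{0..<T}. y t = x t))"

end

theory Submission
  imports Defs
begin

text \<open>
  In the time scale \<open>s = t / \<epsilon>\<close> the system is \<open>X' = \<eta> (f\<^sub>1(X) v\<^sub>1(s) + f\<^sub>2(X) v\<^sub>2(s))\<close> with \<open>\<eta> = \<epsilon>\<close> to the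
  power \<open>1 / (N + 1)\<close> and \<open>1\<close>-periodic \<open>v\<^sub>1, v\<^sub>2\<close>; the assumptions on \<open>J\<close> force \<open>N\<close> to be odd.
  For every word \<open>w\<close> in two letters let \<open>h\<^sub>w\<close> be the iterated Lie derivative of the identity, and
  choose correctors with \<open>K\<^sub>i\<^sub>w' = - v\<^sub>i K\<^sub>w\<close>. The sum of \<open>\<eta>\<^sup>|\<^sup>w\<^sup>| K\<^sub>w(s) h\<^sub>w(X(s))\<close> over the words of length
  at most \<open>N\<close> then varies only at order \<open>\<eta>\<^sup>N\<^sup>+\<^sup>1\<close>. The correctors are trigonometric
  polynomials: for a word with \<open>a\<close> letters \<open>1\<close> and \<open>b\<close> letters \<open>2\<close>, the frequencies of \<open>K\<^sub>w\<close> are sums of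
  \<open>a\<close> terms \<open>\<plusminus>1\<close> and \<open>b\<close> terms \<open>\<plusminus>N\<close>, and \<open>K\<^sub>w\<close> has the parity of \<open>a\<close> under \<open>s \<mapsto> -s\<close>. For
  \<open>a + b \<le> N + 1\<close> a zero frequency occurs only if \<open>a\<close> is even, where the parity excludes a
  secular term, or if \<open>(a, b) = (N, 1)\<close>. So all correctors but the last ones are
  periodic, and the latter add up to \<open>ad\<^sub>f\<^sub>1\<^sup>N f\<^sub>2\<close>. Hence one period moves \<open>x\<close> by
  \<open>- \<epsilon> \<sigma> J\<^sup>(\<^sup>N\<^sup>)(x) + O(\<epsilon> \<eta>)\<close>, which is a contraction towards \<open>x\<^sup>*\<close> up to an error of size \<open>O(\<eta>)\<close>.
\<close>

section \<open>Iterated Lie derivatives\<close>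

lemma C_on_Suc:
  "C_on (Suc k) f D \<longleftrightarrow> (\<forall>x\<in>D. f differentiable at x) \<and> C_on k (deriv f) D"
proof -
  have "(deriv ^^ Suc i) f = (deriv ^^ i) (deriv f)" for i
    by (simp only: funpow_Suc_right o_apply)
  then show ?thesis
    unfolding C_on_def All_less_Suc2 by auto
qed

lemma C_on_0: "C_on 0 f D \<longleftrightarrow> continuous_on D f"
  by (simp add: C_on_def)

lemma deriv_cong_open:
  assumes "open D" "\<And>x. x \<in> D \<Longrightarrow> f x = g x" "x \<in> D"
  shows "deriv f x = deriv g x"
proof (rule deriv_cong_ev)
  show "\<forall>\<^sub>F x in nhds x. f x = g x"
    using eventually_nhds_in_open[OF assms(1,3)] by eventually_elim (rule assms(2))
qed simp

lemma differentiable_cong_open: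
  fixes f g :: "real \<Rightarrow> real"
  assumes "open D" "\<And>x. x \<in> D \<Longrightarrow> f x = g x" "x \<in> D" "f differentiable at x"
  shows "g differentiable at x"
proof -
  from assms(4) obtain F where "(f has_derivative F) (at x)"
    unfolding differentiable_def by blast
  then have "(g has_derivative F) (at x)"
    by (rule has_derivative_transform_within_open[OF _ assms(1,3,2)])
  then show ?thesis unfolding differentiable_def by blast
qed

text \<open>Differentiation rules identify the derivative of a sum or product only on
  \<open>D\<close>. As \<open>D\<close> is open, such an identity survives further differentiation,
  which the inductions below rely on.\<close>

lemma C_on_cong:
  assumes "open D" "\<And>x. x \<in> D \<Longrightarrow> f x = g x" "C_on k f D"
  shows "C_on k g D"
  using assms(2,3)
proof (induction k arbitrary: f g)
  case 0
  then show ?case by (simp add: C_on_0 cong: continuous_on_cong)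
next
  case (Suc k)
  have "deriv f x = deriv g x" if "x \<in> D" for x
    using deriv_cong_open[OF \<open>open D\<close> Suc.prems(1) that] .
  then have "C_on k (deriv g) D"
    using Suc.IH[of "deriv f" "deriv g"] Suc.prems(2) by (simp add: C_on_Suc)
  moreover have "g differentiable at x" if "x \<in> D" for x
    using differentiable_cong_open[of D f g x] \<open>open D\<close> Suc.prems that by (simp add: C_on_Suc)
  ultimately show ?case by (simp add: C_on_Suc)
qed

lemma C_on_imp_continuous_on: "C_on k f D \<Longrightarrow> continuous_on D f"
proof (cases k)
  case (Suc j)
  assume "C_on k f D"
  then show ?thesis
    unfolding Suc C_on_Suc
    by (meson continuous_at_imp_continuous_on differentiable_imp_continuous_within)
qed (simp add: C_on_0)

lemma C_on_mono: "C_on k f D \<Longrightarrow> j \<le> k \<Longrightarrow> C_on j f D"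
proof (induction j arbitrary: k f)
  case 0
  then show ?case by (simp add: C_on_0 C_on_imp_continuous_on)
next
  case (Suc j)
  then obtain k' where "k = Suc k'" by (cases k) auto
  with Suc show ?case by (auto simp: C_on_Suc)
qed

lemma C_on_has_derivative:
  "C_on k f D \<Longrightarrow> 0 < k \<Longrightarrow> x \<in> D \<Longrightarrow> (f has_real_derivative deriv f x) (at x)"
  by (cases k) (auto simp: C_on_Suc DERIV_deriv_iff_real_differentiable)

lemma C_on_deriv: "C_on (Suc k) f D \<Longrightarrow> C_on k (deriv f) D"
  by (simp add: C_on_Suc)

lemma C_on_add:
  assumes "open D" "C_on k f D" "C_on k g D"
  shows "C_on k (\<lambda>x. f x + g x) D"
  using assms(2,3)
proof (induction k arbitrary: f g)
  case 0
  then show ?case by (auto simp: C_on_0 intro: continuous_intros)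
next
  case (Suc k)
  have "C_on k (\<lambda>x. deriv f x + deriv g x) D"
    using Suc by (auto simp: C_on_Suc)
  moreover have "deriv f x + deriv g x = deriv (\<lambda>x. f x + g x) x" if "x \<in> D" for x
    using C_on_has_derivative[OF Suc.prems(1) _ that] C_on_has_derivative[OF Suc.prems(2) _ that]
    by (intro DERIV_imp_deriv[symmetric] DERIV_add) auto
  ultimately have "C_on k (deriv (\<lambda>x. f x + g x)) D"
    by (rule C_on_cong[OF \<open>open D\<close>, rotated])
  then show ?case
    using Suc.prems by (auto simp: C_on_Suc intro!: derivative_intros)
qed

lemma C_on_mult:
  assumes "open D" "C_on k f D" "C_on k g D"
  shows "C_on k (\<lambda>x. f x * g x) D"
  using assms(2,3)
proof (induction k arbitrary: f g)
  case 0
  then show ?case by (auto simp: C_on_0 intro: continuous_intros)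
next
  case (Suc k)
  have "C_on k f D" "C_on k g D"
    using Suc.prems by (auto elim: C_on_mono)
  with Suc have "C_on k (\<lambda>x. deriv f x * g x + deriv g x * f x) D"
    by (auto simp: C_on_Suc intro!: C_on_add \<open>open D\<close>)
  moreover have "deriv f x * g x + deriv g x * f x = deriv (\<lambda>x. f x * g x) x" if "x \<in> D" for x
    using C_on_has_derivative[OF Suc.prems(1) _ that] C_on_has_derivative[OF Suc.prems(2) _ that]
    by (intro DERIV_imp_deriv[symmetric] DERIV_mult) auto
  ultimately have "C_on k (deriv (\<lambda>x. f x * g x)) D"
    by (rule C_on_cong[OF \<open>open D\<close>, rotated])
  then show ?case
    using Suc.prems by (auto simp: C_on_Suc intro!: derivative_intros)
qed

lemma C_on_const: "C_on k (\<lambda>x. c) D"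
  by (induction k arbitrary: c) (auto simp: C_on_0 C_on_Suc intro: continuous_intros)

lemma C_on_ident: "C_on k (\<lambda>x. x) D"
  by (cases k) (auto simp: C_on_0 C_on_Suc C_on_const intro: continuous_intros)

lemma C_on_diff:
  assumes "open D" "C_on k f D" "C_on k g D"
  shows "C_on k (\<lambda>x. f x - g x) D"
  using C_on_add[OF assms(1,2) C_on_mult[OF assms(1) C_on_const[of k "-1"] assms(3)]] by simp

lemma C_on_1_lipschitz:
  assumes "C_on 1 f D" "{a..b} \<subseteq> D"
  obtains L where "L \<ge> 0" "\<And>x y. x \<in> {a..b} \<Longrightarrow> y \<in> {a..b} \<Longrightarrow> \<bar>f x - f y\<bar> \<le> L * \<bar>x - y\<bar>"
proof -
  have "continuous_on {a..b} (deriv f)"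
    using assms by (auto simp: One_nat_def C_on_Suc C_on_0 intro: continuous_on_subset)
  then have "bounded (deriv f ` {a..b})"
    by (intro compact_imp_bounded compact_continuous_image) auto
  then obtain L where L: "\<And>x. x \<in> {a..b} \<Longrightarrow> \<bar>deriv f x\<bar> \<le> L"
    by (metis bounded_iff image_eqI real_norm_def)
  have "\<bar>f x - f y\<bar> \<le> \<bar>L\<bar> * \<bar>x - y\<bar>" if "x \<in> {a..b}" "y \<in> {a..b}" for x y
  proof -
    have "norm (f x - f y) \<le> \<bar>L\<bar> * norm (x - y)"
    proof (rule field_differentiable_bound[of "{a..b}" f "deriv f"])
      fix z assume z: "z \<in> {a..b}"
      with assms(2) have "z \<in> D" by blast
      from C_on_has_derivative[OF assms(1) _ this]
      show "(f has_field_derivative deriv f z) (at z within {a..b})"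
        by (simp add: has_field_derivative_at_within)
      show "norm (deriv f z) \<le> \<bar>L\<bar>" using L[OF z] by simp
    qed (use that in auto)
    then show ?thesis by simp
  qed
  then show ?thesis by (intro that[of "\<bar>L\<bar>"]) auto
qed

lemma C_on_bounded:
  assumes "C_on k f D" "{a..b} \<subseteq> D"
  obtains B where "B \<ge> 0" "\<And>x. x \<in> {a..b} \<Longrightarrow> \<bar>f x\<bar> \<le> B"
proof -
  have "continuous_on {a..b} f"
    using assms C_on_imp_continuous_on continuous_on_subset by blast
  then have "bounded (f ` {a..b})"
    by (intro compact_imp_bounded compact_continuous_image) auto
  then obtain B where "\<And>x. x \<in> {a..b} \<Longrightarrow> \<bar>f x\<bar> \<le> B"
    by (metis bounded_iff image_eqI real_norm_def)
  then show ?thesis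
    by (intro that[of "\<bar>B\<bar>"]) (auto simp: order_trans[OF _ abs_ge_self])
qed

text \<open>Words over \<open>bool\<close> stand for compositions of the derivations \<open>h \<mapsto> h' f\<^sub>1\<close> (\<open>True\<close>) and
  \<open>h \<mapsto> h' f\<^sub>2\<close> (\<open>False\<close>), the head of the list being applied last.\<close>

primrec lie_word :: "(bool \<Rightarrow> real \<Rightarrow> real) \<Rightarrow> bool list \<Rightarrow> (real \<Rightarrow> real) \<Rightarrow> real \<Rightarrow> real" where
  "lie_word f [] h = h"
| "lie_word f (i # w) h = (\<lambda>x. deriv (lie_word f w h) x * f i x)"

lemma lie_word_append: "lie_word f (w @ w') h = lie_word f w (lie_word f w' h)"
  by (induction w) auto

text \<open>Each letter costs \<open>h\<close> one derivative, but the innermost letter multiplies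
  \<open>deriv h\<close> by an undifferentiated field, so the fields need one order less. Hence
  words of length \<open>N + 1\<close> in \<open>C_on (Suc N)\<close> fields, applied to the
  identity, are still \<open>C_on 1\<close>.\<close>

lemma C_on_lie_word:
  assumes "open D" "C_on (k + length w) h D" "\<And>i. C_on (k + length w - 1) (f i) D"
  shows "C_on k (lie_word f w h) D"
  using assms(2,3)
proof (induction w arbitrary: k)
  case (Cons i w)
  have "C_on (Suc k) (lie_word f w h) D"
    using Cons.prems by (intro Cons.IH) auto
  moreover have "C_on k (f i) D"
    using Cons.prems(2) by (rule C_on_mono) auto
  ultimately show ?case
    by (auto intro!: C_on_mult assms C_on_deriv)
qed auto

lemma C_on_lie_bracket:
  assumes "open D" "C_on (Suc k) f D" "C_on (Suc k) g D"
  shows "C_on k (lie_bracket f g) D"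
proof -
  have "C_on k f D" "C_on k g D"
    using assms by (auto elim: C_on_mono)
  then show ?thesis
    unfolding lie_bracket_def
    using assms by (intro C_on_diff C_on_mult) (simp_all add: C_on_Suc)
qed

lemma C_on_ad_pow:
  assumes "open D" "C_on (n + k) f D" "C_on (n + k) g D"
  shows "C_on k (ad_pow f n g) D"
  using assms(2,3)
proof (induction n arbitrary: k)
  case 0
  then show ?case by (simp add: ad_pow_def)
next
  case (Suc n)
  have "C_on (Suc k) (ad_pow f n g) D" using Suc.prems by (intro Suc.IH) auto
  moreover have "C_on (Suc k) f D" using Suc.prems(1) by (rule C_on_mono) auto
  ultimately have "C_on k (lie_bracket f (ad_pow f n g)) D"
    using assms(1) by (intro C_on_lie_bracket)
  then show ?case by (simp add: ad_pow_def)
qed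

text \<open>The vector field \<open>ad\<^sub>f\<^sup>n g\<close> acts as the derivation that is the \<open>n\<close>-fold commutator of the
  derivations \<open>h \<mapsto> h' f\<close> and \<open>h \<mapsto> h' g\<close>.\<close>

lemma ad_pow_as_lie_words:
  assumes "open D" "C_on (Suc n) h D" "\<And>i. C_on n (f i) D" "x \<in> D"
  shows "deriv h x * ad_pow (f True) n (f False) x =
    (\<Sum>l\<le>n. (-1) ^ (n - l) * real (n choose l) *
       lie_word f (replicate l True @ False # replicate (n - l) True) h x)"
  using assms(2-4)
proof (induction n arbitrary: h x)
  case 0
  then show ?case by (simp add: ad_pow_def)
next
  case (Suc n)
  define G where "G = ad_pow (f True) n (f False)"
  \<comment> \<open>The induction hypothesis is used for \<open>h\<close> and for its image
    \<open>h1\<close> under the derivation of \<open>f True\<close>; this gives the two halves of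
    the commutator.\<close>
  define h1 where "h1 = (\<lambda>x. deriv h x * f True x)"
  define T where "T l j = lie_word f (replicate l True @ False # replicate j True) h" for l j
  define c where "c l = (-1) ^ (n - l) * real (n choose l)" for l
  have G1: "C_on 1 G D"
    unfolding G_def using Suc.prems(2) by (intro C_on_ad_pow \<open>open D\<close>) auto
  have fC: "C_on n (f i) D" for i using Suc.prems(2) by (rule C_on_mono) auto
  have hC: "C_on (Suc n) h D" using Suc.prems(1) by (rule C_on_mono) auto
  have h1C: "C_on (Suc n) h1 D"
    unfolding h1_def using Suc.prems by (intro C_on_mult \<open>open D\<close>) (auto simp: C_on_Suc)
  have TC: "C_on 1 (T l (n - l)) D" if "l \<le> n" for l
    unfolding T_def using that Suc.prems by (intro C_on_lie_word \<open>open D\<close>) auto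
  have IH: "deriv h y * G y = (\<Sum>l\<le>n. c l * T l (n - l) y)" if "y \<in> D" for y
    unfolding G_def T_def c_def using Suc.IH[OF hC fC that] .
  have IH1: "deriv h1 x * G x = (\<Sum>l\<le>n. c l * T l (Suc n - l) x)"
  proof -
    \<comment> \<open>Starting from \<open>h1\<close> adds a \<open>True\<close> at the inner end,
      that is, to the block right of \<open>False\<close>.\<close>
    have "lie_word f (replicate l True @ False # replicate (n - l) True) h1 = T l (Suc n - l)"
      if "l \<le> n" for l
    proof -
      have "h1 = lie_word f [True] h" by (simp add: h1_def)
      moreover have "replicate (n - l) True @ [True] = replicate (Suc n - l) True"
        using that by (simp add: Suc_diff_le replicate_append_same)
      ultimately show ?thesis
        unfolding T_def by (metis append_Cons append_assoc lie_word_append)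
    qed
    then show ?thesis
      unfolding G_def c_def Suc.IH[OF h1C fC \<open>x \<in> D\<close>] by (intro sum.cong refl) simp
  qed
  have "deriv (\<lambda>y. deriv h y * G y) x = deriv (\<lambda>y. \<Sum>l\<le>n. c l * T l (n - l) y) x"
    by (rule deriv_cong_open[OF \<open>open D\<close> IH \<open>x \<in> D\<close>])
  also have "\<dots> = (\<Sum>l\<le>n. c l * deriv (T l (n - l)) x)"
    using C_on_has_derivative[OF TC _ \<open>x \<in> D\<close>]
    by (intro DERIV_imp_deriv DERIV_sum DERIV_cmult) auto
  finally have A: "deriv (\<lambda>y. deriv h y * G y) x * f True x = (\<Sum>l\<le>n. c l * T (Suc l) (n - l) x)"
    by (simp add: sum_distrib_right T_def mult.assoc)
  have dh: "(deriv h has_real_derivative deriv (deriv h) x) (at x)"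
    using Suc.prems by (intro C_on_has_derivative[where k="Suc n" and D=D]) (auto simp: C_on_Suc)
  have df: "(f True has_real_derivative deriv (f True) x) (at x)"
    using Suc.prems by (intro C_on_has_derivative[where k="Suc n" and D=D]) auto
  have dG: "(G has_real_derivative deriv G x) (at x)"
    using G1 Suc.prems by (intro C_on_has_derivative[where D=D]) auto
  have d1: "deriv (\<lambda>y. deriv h y * G y) x = deriv (deriv h) x * G x + deriv G x * deriv h x"
    by (intro DERIV_imp_deriv DERIV_mult dh dG)
  have d2: "deriv h1 x = deriv (deriv h) x * f True x + deriv (f True) x * deriv h x"
    unfolding h1_def by (intro DERIV_imp_deriv DERIV_mult dh df)
  \<comment> \<open>The terms with \<open>deriv (deriv h)\<close> cancel, so the commutator is again
    a derivation.\<close>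
  have "deriv h x * ad_pow (f True) (Suc n) (f False) x =
      deriv (\<lambda>y. deriv h y * G y) x * f True x - deriv h1 x * G x"
    unfolding d1 d2 by (simp add: ad_pow_def lie_bracket_def G_def algebra_simps)
  also have "\<dots> = (\<Sum>l\<le>n. c l * T (Suc l) (n - l) x) - (\<Sum>l\<le>n. c l * T l (Suc n - l) x)"
    unfolding A IH1 ..
  also have "\<dots> = (\<Sum>l\<le>Suc n. (-1) ^ (Suc n - l) * real (Suc n choose l) * T l (Suc n - l) x)"
  proof -
    \<comment> \<open>Zero coefficients extend both sums to \<open>l \<le> Suc n\<close>; the
      coefficients then combine by Pascal's rule.\<close>
    have 1: "(\<Sum>l\<le>n. c l * T (Suc l) (n - l) x) =
        (\<Sum>l\<le>Suc n. (if l = 0 then 0 else c (l - 1)) * T l (Suc n - l) x)"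
      by (subst sum.atMost_Suc_shift) simp
    have 2: "(\<Sum>l\<le>n. c l * T l (Suc n - l) x) =
        (\<Sum>l\<le>Suc n. (if l = Suc n then 0 else c l) * T l (Suc n - l) x)"
      by simp
    have 3: "(if l = 0 then 0 else c (l - 1)) - (if l = Suc n then 0 else c l) =
        (-1) ^ (Suc n - l) * real (Suc n choose l)" if le: "l \<le> Suc n" for l
    proof -
      consider "l = 0" | "l = Suc n" | p where "l = Suc p" "p < n"
        using le by (cases l; cases "l = Suc n") auto
      then show ?thesis
      proof cases
        case 3
        then have "n - p = Suc (n - Suc p)" by simp
        then show ?thesis using 3 by (simp add: c_def algebra_simps)
      qed (simp_all add: c_def)
    qed
    show ?thesis
      unfolding 1 2 sum_subtractf[symmetric] left_diff_distrib[symmetric]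
      by (intro sum.cong refl) (simp only: 3 atMost_iff)
  qed
  finally show ?case unfolding T_def .
qed

section \<open>Resonances of trigonometric polynomials\<close>

text \<open>Frequencies, in multiples of the base frequency, of a product of \<open>a\<close> factors of frequency
  \<open>1\<close> and \<open>b\<close> factors of frequency \<open>N\<close>.\<close>

definition freqs :: "nat \<Rightarrow> nat \<Rightarrow> nat \<Rightarrow> int set" where
  "freqs N a b = {p + int N * q | p q. \<bar>p\<bar> \<le> int a \<and> \<bar>q\<bar> \<le> int b \<and> even (p - int a) \<and> even (q - int b)}"

lemma freqs_0: "0 \<in> freqs N 0 0"
  unfolding freqs_def by force

lemma freqs_Suc1: "n \<in> freqs N a b \<Longrightarrow> n + 1 \<in> freqs N (Suc a) b \<and> n - 1 \<in> freqs N (Suc a) b"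
proof -
  assume "n \<in> freqs N a b"
  then obtain p q where *: "n = p + int N * q" "\<bar>p\<bar> \<le> int a" "\<bar>q\<bar> \<le> int b" "even (p - int a)" "even (q - int b)"
    unfolding freqs_def by blast
  have "n + 1 = (p + 1) + int N * q" "\<bar>p + 1\<bar> \<le> int (Suc a)" "even (p + 1 - int (Suc a))"
    "n - 1 = (p - 1) + int N * q" "\<bar>p - 1\<bar> \<le> int (Suc a)" "even (p - 1 - int (Suc a))"
    using * by auto
  with * show ?thesis unfolding freqs_def by blast
qed

lemma freqs_Suc2: "n \<in> freqs N a b \<Longrightarrow> n + int N \<in> freqs N a (Suc b) \<and> n - int N \<in> freqs N a (Suc b)"
proof -
  assume "n \<in> freqs N a b"
  then obtain p q where *: "n = p + int N * q" "\<bar>p\<bar> \<le> int a" "\<bar>q\<bar> \<le> int b" "even (p - int a)" "even (q - int b)"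
    unfolding freqs_def by blast
  have "n + int N = p + int N * (q + 1)" "\<bar>q + 1\<bar> \<le> int (Suc b)" "even (q + 1 - int (Suc b))"
    "n - int N = p + int N * (q - 1)" "\<bar>q - 1\<bar> \<le> int (Suc b)" "even (q - 1 - int (Suc b))"
    using * by (auto simp: algebra_simps)
  with * show ?thesis unfolding freqs_def by blast
qed

text \<open>If \<open>a\<close> is odd and \<open>p + N * q\<close> vanishes, then \<open>p\<close>
  is odd, so \<open>q\<close> is nonzero and \<open>\<bar>p\<bar> \<ge> N\<close>. This forces
  \<open>N \<le> a\<close> and \<open>1 \<le> b\<close>, leaving only the excluded pair.\<close>

lemma zero_in_freqs_imp_even:
  assumes "odd N" "a + b \<le> N + 1" "(a, b) \<noteq> (N, 1)" "0 \<in> freqs N a b"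
  shows "even a"
proof (rule ccontr)
  assume "odd a"
  from assms(4) obtain p q where *: "p = - (int N * q)" "\<bar>p\<bar> \<le> int a" "\<bar>q\<bar> \<le> int b" "even (p - int a)"
    unfolding freqs_def by (auto simp: eq_neg_iff_add_eq_0)
  have "odd p" using * \<open>odd a\<close> by simp
  then have "q \<noteq> 0" using * by auto
  then have "b \<ge> 1" using * by linarith
  have "int N * 1 \<le> int N * \<bar>q\<bar>" using \<open>q \<noteq> 0\<close> by (intro mult_left_mono) auto
  also have "\<dots> = \<bar>p\<bar>" using * by (simp add: abs_mult)
  finally have "N \<le> a" using * by linarith
  with \<open>b \<ge> 1\<close> assms(2,3) show False by auto
qed

text \<open>The phase \<open>a \<pi> / 2\<close> makes these functions even in \<open>s\<close> for even \<open>a\<close> and odd for odd \<open>a\<close>.\<close>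

inductive trig :: "nat \<Rightarrow> real \<Rightarrow> nat \<Rightarrow> nat \<Rightarrow> (real \<Rightarrow> real) \<Rightarrow> bool" for N \<omega> a b where
  base: "n \<in> freqs N a b \<Longrightarrow> trig N \<omega> a b (\<lambda>s. c * cos (of_int n * \<omega> * s - real a * pi / 2))"
| add: "trig N \<omega> a b g \<Longrightarrow> trig N \<omega> a b h \<Longrightarrow> trig N \<omega> a b (\<lambda>s. g s + h s)"

lemma trig_cmult: "trig N \<omega> a b g \<Longrightarrow> trig N \<omega> a b (\<lambda>s. c * g s)"
proof (induction rule: trig.induct)
  case (base n c')
  from trig.base[OF this, where c="c * c'"] show ?case by (simp add: mult.assoc)
next
  case (add g h)
  then show ?case by (simp add: distrib_left trig.add)
qed

text \<open>All frequencies are integer multiples of \<open>2 * pi * \<kappa>\<close>, so a unit of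
  time is a whole number of oscillations of every summand.\<close>

lemma trig_periodic: "trig N (2 * pi * real \<kappa>) a b g \<Longrightarrow> g 1 = g 0"
proof (induction rule: trig.induct)
  case (base n c)
  have "cos (of_int n * (2 * pi * real \<kappa>) * 1 - real a * pi / 2) =
      cos (- (real a * pi / 2) + 2 * pi * of_int (n * int \<kappa>))"
    by (rule arg_cong[where f=cos]) simp
  also have "\<dots> = cos (of_int n * (2 * pi * real \<kappa>) * 0 - real a * pi / 2)"
    by (simp only: cos_add sin_int_2pin cos_int_2pin) simp
  finally show ?case by simp
qed auto

lemma trig_1: "trig N \<omega> 0 0 (\<lambda>s. 1)"
  using trig.base[OF freqs_0, where c=1] by simp

text \<open>Raising \<open>a\<close> by one shifts the phase by a quarter turn; this brings sine
  terms into the cosine form required by \<open>trig\<close>.\<close>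

lemma cos_minus_phase_Suc: "cos (x - real (Suc a) * pi / 2) = sin (x - real a * pi / 2)"
proof -
  have "x - real (Suc a) * pi / 2 = (x - real a * pi / 2) - pi / 2"
    by (simp add: field_simps)
  then show ?thesis by (simp only: cos_diff) simp
qed

lemma sin_minus_phase_Suc: "sin (x - real (Suc a) * pi / 2) = - cos (x - real a * pi / 2)"
proof -
  have "x - real (Suc a) * pi / 2 = (x - real a * pi / 2) - pi / 2"
    by (simp add: field_simps)
  then show ?thesis by (simp only: sin_diff) simp
qed

lemma sin_times_cos_shifted:
  "sin y * cos (x - p) = (sin (x + y - p) - sin (x - y - p)) / (2::real)"
proof -
  have "2 * (sin y * cos (x - p)) = sin ((x - p) + y) - sin ((x - p) - y)"
    using sin_add[of "x - p" y] sin_diff[of "x - p" y] by simp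
  moreover have "(x - p) + y = x + y - p" "(x - p) - y = x - y - p" by simp_all
  ultimately show ?thesis by simp
qed

lemma cos_times_cos_shifted:
  "cos y * cos (x - p) = (cos (x + y - p) + cos (x - y - p)) / (2::real)"
proof -
  have "2 * (cos y * cos (x - p)) = cos ((x - p) + y) + cos ((x - p) - y)"
    using cos_add[of "x - p" y] cos_diff[of "x - p" y] by simp
  moreover have "(x - p) + y = x + y - p" "(x - p) - y = x - y - p" by simp_all
  ultimately show ?thesis by simp
qed

text \<open>The odd factor \<open>sin (\<omega> * s)\<close> reverses the parity in
  \<open>s\<close>, matching the step from \<open>a\<close> to \<open>Suc a\<close>. This serves the
  correctors of words without \<open>False\<close>, which are powers of a sine.\<close>

lemma trig_mult_sin: "trig N \<omega> a 0 g \<Longrightarrow> trig N \<omega> (Suc a) 0 (\<lambda>s. sin (\<omega> * s) * g s)"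
proof (induction rule: trig.induct)
  case (base n c)
  have 1: "sin (\<omega> * s) * cos (x - real a * pi / 2) =
    (cos (x + \<omega> * s - real (Suc a) * pi / 2) - cos (x - \<omega> * s - real (Suc a) * pi / 2)) / 2" for s x
    unfolding cos_minus_phase_Suc by (rule sin_times_cos_shifted)
  have "trig N \<omega> (Suc a) 0 (\<lambda>s. c / 2 * cos (of_int (n + 1) * \<omega> * s - real (Suc a) * pi / 2) +
      (- c / 2) * cos (of_int (n - 1) * \<omega> * s - real (Suc a) * pi / 2))"
    using freqs_Suc1[OF base] by (intro trig.intros) auto
  also have "(\<lambda>s. c / 2 * cos (of_int (n + 1) * \<omega> * s - real (Suc a) * pi / 2) +
      (- c / 2) * cos (of_int (n - 1) * \<omega> * s - real (Suc a) * pi / 2)) =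
    (\<lambda>s. sin (\<omega> * s) * (c * cos (of_int n * \<omega> * s - real a * pi / 2)))"
  proof
    fix s
    have "of_int (n + 1) * \<omega> * s = of_int n * \<omega> * s + \<omega> * s"
      "of_int (n - 1) * \<omega> * s = of_int n * \<omega> * s - \<omega> * s"
      by (simp_all add: algebra_simps)
    moreover have "c / 2 * A + (- c / 2) * B = c * ((A - B) / 2)" for A B :: real
      by (simp add: field_simps)
    ultimately show "c / 2 * cos (of_int (n + 1) * \<omega> * s - real (Suc a) * pi / 2) +
      (- c / 2) * cos (of_int (n - 1) * \<omega> * s - real (Suc a) * pi / 2) =
      sin (\<omega> * s) * (c * cos (of_int n * \<omega> * s - real a * pi / 2))"
      using 1[of s "of_int n * \<omega> * s"] by (simp only: mult.left_commute[of _ c])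
  qed
  finally show ?case .
next
  case (add g h)
  then show ?case by (simp add: distrib_left trig.add)
qed

lemma trig_sin_power: "trig N \<omega> j 0 (\<lambda>s. (c * sin (\<omega> * s)) ^ j)"
proof (induction j)
  case 0
  then show ?case by (simp add: trig_1)
next
  case (Suc j)
  from trig_cmult[OF trig_mult_sin[OF this], of c] show ?case by (simp add: mult_ac)
qed

text \<open>For \<open>n = 0\<close> the integrand is a constant, which vanishes if \<open>a\<close> is even.\<close>

lemma trig_antiderivative_sin:
  assumes "\<omega> > 0" "n \<in> freqs N a b" "n \<noteq> 0 \<or> even a"
  obtains G where "trig N \<omega> a b G"
    "\<And>s. (G has_real_derivative c * sin (of_int n * \<omega> * s - real a * pi / 2)) (at s)"
proof (cases "n = 0")
  case True
  with assms(3) obtain k where "a = 2 * k" by auto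
  then have "real a * pi / 2 = real k * pi" by simp
  then have "sin (of_int n * \<omega> * s - real a * pi / 2) = 0" for s
    using True by (simp add: sin_npi)
  then show ?thesis
    using trig.base[OF assms(2), where c=0] by (intro that) auto
next
  case False
  have "((\<lambda>s. - c / (of_int n * \<omega>) * cos (of_int n * \<omega> * s - real a * pi / 2)) has_real_derivative
    c * sin (of_int n * \<omega> * s - real a * pi / 2)) (at s)" for s
    using False \<open>\<omega> > 0\<close> by (auto intro!: derivative_eq_intros)
  then show ?thesis
    using trig.base[OF assms(2)] by (intro that)
qed

text \<open>The even cosine keeps the parity and integration reverses it, so the result belongs to
  \<open>Suc a\<close>. The last hypothesis makes every term of frequency zero in the integrand
  vanish, so no secular term appears.\<close>

lemma trig_antiderivative_cos_mult:
  assumes "\<omega> > 0" "trig N \<omega> a b g" "0 \<in> freqs N (Suc a) b \<Longrightarrow> even (Suc a)"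
  shows "\<exists>G. trig N \<omega> (Suc a) b G \<and> (\<forall>s. (G has_real_derivative c * cos (\<omega> * s) * g s) (at s))"
  using assms(2)
proof (induction rule: trig.induct)
  case (base n c')
  note fr = freqs_Suc1[OF base]
  have 1: "cos (\<omega> * s) * cos (x - real a * pi / 2) =
    - (sin (x + \<omega> * s - real (Suc a) * pi / 2) + sin (x - \<omega> * s - real (Suc a) * pi / 2)) / 2" for s x
    unfolding sin_minus_phase_Suc cos_times_cos_shifted by simp
  from fr assms(3) have e: "n + 1 \<noteq> 0 \<or> even (Suc a)" "n - 1 \<noteq> 0 \<or> even (Suc a)" by metis+
  obtain G H where G: "trig N \<omega> (Suc a) b G"
    "\<And>s. (G has_real_derivative (- c * c' / 2) * sin (of_int (n + 1) * \<omega> * s - real (Suc a) * pi / 2)) (at s)"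
    and H: "trig N \<omega> (Suc a) b H"
    "\<And>s. (H has_real_derivative (- c * c' / 2) * sin (of_int (n - 1) * \<omega> * s - real (Suc a) * pi / 2)) (at s)"
    using trig_antiderivative_sin[OF \<open>\<omega> > 0\<close> conjunct1[OF fr] e(1)]
      trig_antiderivative_sin[OF \<open>\<omega> > 0\<close> conjunct2[OF fr] e(2)] by metis
  have "((\<lambda>s. G s + H s) has_real_derivative
      c * cos (\<omega> * s) * (c' * cos (of_int n * \<omega> * s - real a * pi / 2))) (at s)" for s
  proof -
    have "of_int (n + 1) * \<omega> * s = of_int n * \<omega> * s + \<omega> * s"
      "of_int (n - 1) * \<omega> * s = of_int n * \<omega> * s - \<omega> * s"
      by (simp_all add: algebra_simps)
    moreover have "c * c' * (- (A + B) / 2) = (- c * c' / 2) * A + (- c * c' / 2) * B" for A B :: real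
      by (simp add: field_simps)
    ultimately have "c * c' * (cos (\<omega> * s) * cos (of_int n * \<omega> * s - real a * pi / 2)) = (- c * c' / 2) * sin (of_int (n + 1) * \<omega> * s - real (Suc a) * pi / 2) +
        (- c * c' / 2) * sin (of_int (n - 1) * \<omega> * s - real (Suc a) * pi / 2)"
      using 1[of s "of_int n * \<omega> * s"] by (simp only:)
    then show ?thesis using DERIV_add[OF G(2) H(2), of s] by (simp only: mult_ac)
  qed
  then show ?case using trig.add[OF G(1) H(1)] by blast
next
  case (add g h)
  then obtain G H where "trig N \<omega> (Suc a) b G" "\<forall>s. (G has_real_derivative c * cos (\<omega> * s) * g s) (at s)"
    "trig N \<omega> (Suc a) b H" "\<forall>s. (H has_real_derivative c * cos (\<omega> * s) * h s) (at s)" by blast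
  then show ?case
    by (intro exI[of _ "\<lambda>s. G s + H s"]) (auto simp: distrib_left intro: trig.add DERIV_add)
qed

text \<open>The sine factor and the integration each reverse the parity, so \<open>a\<close> stays
  and only \<open>b\<close> grows.\<close>

lemma trig_antiderivative_sin_mult:
  assumes "\<omega> > 0" "trig N \<omega> a b g" "0 \<in> freqs N a (Suc b) \<Longrightarrow> even a"
  shows "\<exists>G. trig N \<omega> a (Suc b) G \<and> (\<forall>s. (G has_real_derivative c * sin (real N * \<omega> * s) * g s) (at s))"
  using assms(2)
proof (induction rule: trig.induct)
  case (base n c')
  note fr = freqs_Suc2[OF base]
  have 1: "sin y * cos (x - real a * pi / 2) =
    (sin (x + y - real a * pi / 2) - sin (x - y - real a * pi / 2)) / 2" for x y
    by (rule sin_times_cos_shifted)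
  from fr assms(3) have e: "n + int N \<noteq> 0 \<or> even a" "n - int N \<noteq> 0 \<or> even a" by metis+
  obtain G H where G: "trig N \<omega> a (Suc b) G"
    "\<And>s. (G has_real_derivative (c * c' / 2) * sin (of_int (n + int N) * \<omega> * s - real a * pi / 2)) (at s)"
    and H: "trig N \<omega> a (Suc b) H"
    "\<And>s. (H has_real_derivative (- c * c' / 2) * sin (of_int (n - int N) * \<omega> * s - real a * pi / 2)) (at s)"
    using trig_antiderivative_sin[OF \<open>\<omega> > 0\<close> conjunct1[OF fr] e(1)]
      trig_antiderivative_sin[OF \<open>\<omega> > 0\<close> conjunct2[OF fr] e(2)] by metis
  have "((\<lambda>s. G s + H s) has_real_derivative
      c * sin (real N * \<omega> * s) * (c' * cos (of_int n * \<omega> * s - real a * pi / 2))) (at s)" for s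
  proof -
    have "of_int (n + int N) * \<omega> * s = of_int n * \<omega> * s + real N * \<omega> * s"
      "of_int (n - int N) * \<omega> * s = of_int n * \<omega> * s - real N * \<omega> * s"
      by (simp_all add: algebra_simps)
    moreover have "c * c' * ((A - B) / 2) = (c * c' / 2) * A + (- c * c' / 2) * B" for A B :: real
      by (simp add: field_simps)
    ultimately have "c * c' * (sin (real N * \<omega> * s) * cos (of_int n * \<omega> * s - real a * pi / 2)) = (c * c' / 2) * sin (of_int (n + int N) * \<omega> * s - real a * pi / 2) +
        (- c * c' / 2) * sin (of_int (n - int N) * \<omega> * s - real a * pi / 2)"
      using 1[of "real N * \<omega> * s" "of_int n * \<omega> * s"] by (simp only:)
    then show ?thesis using DERIV_add[OF G(2) H(2), of s] by (simp only: mult_ac)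
  qed
  then show ?case using trig.add[OF G(1) H(1)] by blast
next
  case (add g h)
  then obtain G H where "trig N \<omega> a (Suc b) G" "\<forall>s. (G has_real_derivative c * sin (real N * \<omega> * s) * g s) (at s)"
    "trig N \<omega> a (Suc b) H" "\<forall>s. (H has_real_derivative c * sin (real N * \<omega> * s) * h s) (at s)" by blast
  then show ?case
    by (intro exI[of _ "\<lambda>s. G s + H s"]) (auto simp: distrib_left intro: trig.add DERIV_add)
qed

section \<open>Periodic correctors\<close>

lemma has_integral_FTC:
  assumes "\<And>s. (G has_real_derivative g s) (at s)"
  shows "(g has_integral G 1 - G 0) {0..1::real}"
proof (rule fundamental_theorem_of_calculus)
  show "(G has_vector_derivative g s) (at s within {0..1})" for s
    using has_field_derivative_at_within[OF assms]
    by (simp add: has_real_derivative_iff_has_vector_derivative)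
qed simp

text \<open>\<open>cos y ^ n\<close> contains only harmonics up to \<open>n\<close>, hence is
  orthogonal to the harmonic \<open>Suc p > n\<close>. The induction trades one factor
  \<open>cos y\<close> for the harmonics \<open>p\<close> and \<open>p + 2\<close>.\<close>

lemma cos_power_mult_cos_has_integral_0:
  assumes "\<kappa> \<ge> 1" "n \<le> p"
  shows "((\<lambda>s. cos (2 * pi * real \<kappa> * s - pi / 2) ^ n *
    cos (real (Suc p) * (2 * pi * real \<kappa> * s - pi / 2))) has_integral 0) {0..1}"
  using assms(2)
proof (induction n arbitrary: p)
  case 0
  let ?G = "\<lambda>s. sin (real (Suc p) * (2 * pi * real \<kappa> * s - pi / 2)) / (real (Suc p) * (2 * pi * real \<kappa>))"
  have "sin (real (Suc p) * (2 * pi * real \<kappa> * 1 - pi / 2)) =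
      sin (real (Suc p) * (- (pi / 2)) + 2 * pi * of_int (int (Suc p * \<kappa>)))"
    by (rule arg_cong[where f=sin]) (simp add: algebra_simps)
  also have "\<dots> = sin (real (Suc p) * (2 * pi * real \<kappa> * 0 - pi / 2))"
    by (simp only: sin_add sin_int_2pin cos_int_2pin) simp
  finally have "?G 1 - ?G 0 = 0" by simp
  moreover have "(?G has_real_derivative cos (real (Suc p) * (2 * pi * real \<kappa> * s - pi / 2))) (at s)" for s
  proof -
    have "((\<lambda>s. sin (c * (w * s - q)) / (c * w)) has_real_derivative cos (c * (w * s - q))) (at s)"
      if "c * w \<noteq> 0" for c w q :: real
      using that by (auto intro!: derivative_eq_intros simp: mult.commute)
    then show ?thesis using assms(1) by simp
  qed
  ultimately show ?case
    using has_integral_FTC[of ?G "\<lambda>s. cos (real (Suc p) * (2 * pi * real \<kappa> * s - pi / 2))"] by simp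
next
  case (Suc n)
  then obtain p' where p: "p = Suc p'" by (cases p) auto
  have e: "1/2 * (cos y ^ n * cos (real (Suc (Suc p)) * y)) + 1/2 * (cos y ^ n * cos (real (Suc p') * y)) =
    cos y ^ Suc n * cos (real (Suc p) * y)" for y
  proof -
    have "cos (real (Suc (Suc p)) * y) + cos (real (Suc p') * y) = 2 * (cos y * cos (real (Suc p) * y))"
      using cos_add[of "real (Suc p) * y" y] cos_diff[of "real (Suc p) * y" y]
      by (simp add: algebra_simps p)
    then have "cos y ^ n * (cos (real (Suc (Suc p)) * y) + cos (real (Suc p') * y)) =
      cos y ^ n * (2 * (cos y * cos (real (Suc p) * y)))" by simp
    then show ?thesis by (simp add: algebra_simps)
  qed
  from has_integral_add[OF has_integral_mult_right[OF Suc.IH[of "Suc p"], of "1/2"]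
      has_integral_mult_right[OF Suc.IH[of p'], of "1/2"]] Suc.prems p
  show ?case unfolding e by simp
qed

text \<open>The same identity leaves the harmonics \<open>n\<close> and \<open>n + 2\<close> against
  \<open>cos y ^ n\<close>: the higher one has mean zero, the lower one contributes half of the
  previous value.\<close>

lemma cos_power_mult_cos_has_integral:
  assumes "\<kappa> \<ge> 1"
  shows "((\<lambda>s. cos (2 * pi * real \<kappa> * s - pi / 2) ^ n *
    cos (real n * (2 * pi * real \<kappa> * s - pi / 2))) has_integral 1 / 2 ^ n) {0..1}"
proof (induction n)
  case 0
  show ?case using has_integral_const_real[of "1::real" 0 1] by simp
next
  case (Suc n)
  have e: "1/2 * (cos y ^ n * cos (real (Suc (Suc n)) * y)) + 1/2 * (cos y ^ n * cos (real n * y)) =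
    cos y ^ Suc n * cos (real (Suc n) * y)" for y
  proof -
    have "cos (real (Suc (Suc n)) * y) + cos (real n * y) = 2 * (cos y * cos (real (Suc n) * y))"
      using cos_add[of "real (Suc n) * y" y] cos_diff[of "real (Suc n) * y" y]
      by (simp add: algebra_simps)
    then have "cos y ^ n * (cos (real (Suc (Suc n)) * y) + cos (real n * y)) =
      cos y ^ n * (2 * (cos y * cos (real (Suc n) * y)))" by simp
    then show ?thesis by (simp add: algebra_simps)
  qed
  from has_integral_add[OF has_integral_mult_right[OF cos_power_mult_cos_has_integral_0[OF assms, of n "Suc n"], of "1/2"]
      has_integral_mult_right[OF Suc.IH, of "1/2"]]
  show ?case unfolding e by simp
qed

text \<open>A quarter turn converts the cosine formula: for odd \<open>N\<close> it changes the
  harmonic \<open>N\<close> into a sine with the sign \<open>(-1) ^ (N div 2)\<close>.\<close>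

lemma sin_power_mult_sin_has_integral:
  assumes "\<kappa> \<ge> 1" "odd N"
  shows "((\<lambda>s. sin (2 * pi * real \<kappa> * s) ^ N * sin (real N * (2 * pi * real \<kappa>) * s))
    has_integral (-1) ^ (N div 2) / 2 ^ N) {0..1}"
proof -
  have e: "(-1) ^ (N div 2) * (cos (x - pi / 2) ^ N * cos (real N * (x - pi / 2))) = sin x ^ N * sin (real N * x)" for x
  proof -
    define k where "k = N div 2"
    have N: "real N = 2 * real k + 1"
      using assms(2) unfolding k_def by (metis Suc_eq_plus1 odd_two_times_div_two_succ of_nat_1 of_nat_add of_nat_mult of_nat_numeral)
    have "real N * (x - pi / 2) = (real N * x - real k * pi) - pi / 2"
      unfolding N by (simp add: algebra_simps)
    then have "cos (real N * (x - pi / 2)) = sin (real N * x - real k * pi)"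
      by (simp only: cos_diff[of _ "pi / 2"]) simp
    also have "\<dots> = (-1) ^ k * sin (real N * x)"
      by (simp add: sin_diff sin_npi cos_npi)
    finally have "cos (real N * (x - pi / 2)) = (-1) ^ k * sin (real N * x)" .
    moreover have "cos (x - pi / 2) = sin x" by (simp add: cos_diff)
    moreover have "(-1) ^ k * ((-1) ^ k * z) = z" for z :: real
      by (simp flip: mult.assoc power_add add: mult_2[symmetric])
    ultimately show ?thesis unfolding k_def[symmetric] by (simp add: mult.left_commute)
  qed
  show ?thesis
    using has_integral_mult_right[OF cos_power_mult_cos_has_integral[OF assms(1), of N], of "(-1) ^ (N div 2)"]
    unfolding e by (simp add: mult.assoc)
qed

section \<open>Construction of the correctors and their moments\<close>

lemma DERIV_power_div_fact:
  fixes u :: "real \<Rightarrow> real"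
  assumes "(u has_real_derivative d) (at s)"
  shows "((\<lambda>s. u s ^ Suc j / fact (Suc j)) has_real_derivative d * (u s ^ j / fact j)) (at s)"
  by (rule DERIV_cong[OF DERIV_cdivide[OF DERIV_power[OF assms]]]) (simp del: of_nat_Suc)

text \<open>Antiderivatives are not unique. They are chosen by \<open>SOME\<close> subject to a
  predicate \<open>P\<close>, which is to carry the structure that the next letter relies
  on.\<close>

primrec corrector :: "(bool \<Rightarrow> real \<Rightarrow> real) \<Rightarrow> (bool list \<Rightarrow> (real \<Rightarrow> real) \<Rightarrow> bool) \<Rightarrow> bool list \<Rightarrow> real \<Rightarrow> real"
where
  "corrector v P [] = (\<lambda>s. 1)"
| "corrector v P (i # w) = (SOME G.
    (\<forall>s. (G has_real_derivative - (v i s * corrector v P w s)) (at s)) \<and> P (i # w) G)"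

text \<open>Serves the words with \<open>N\<close> letters \<open>True\<close> and one
  \<open>False\<close>, whose correctors may contain a secular term.\<close>

lemma antiderivative_exists:
  fixes g :: "real \<Rightarrow> real"
  assumes "\<And>x. isCont g x"
  shows "\<exists>G. \<forall>x. (G has_real_derivative g x) (at x)"
  using einterval_antiderivative[of "-\<infinity>" "\<infinity>" g] assms
  by (auto simp: has_real_derivative_iff_has_vector_derivative)

lemma length_eq_count_bool: "length w = count_list w True + count_list w False"
  by (induction w) auto

text \<open>Induction on the word stays in the class \<open>trig\<close> away from the resonance
  \<open>(N, 1)\<close>. Nonempty words without \<open>False\<close> get the antiderivative
  vanishing at \<open>0\<close>, an explicit power of a sine, from which the moments are computed
  later.\<close>

lemma correctors_exist:
  fixes N \<kappa> :: nat and c1 c2 :: real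
  defines "\<omega> \<equiv> 2 * pi * real \<kappa>"
  defines "v \<equiv> (\<lambda>i s. if i then c1 * cos (\<omega> * s) else c2 * sin (real N * \<omega> * s))"
  assumes "odd N" "\<kappa> \<ge> 1"
  obtains K :: "bool list \<Rightarrow> real \<Rightarrow> real" where
    "K [] = (\<lambda>s. 1)"
    "\<And>w i s. length w \<le> N \<Longrightarrow> (K (i # w) has_real_derivative - (v i s * K w s)) (at s)"
    "\<And>w. length w \<le> N + 1 \<Longrightarrow> (count_list w True, count_list w False) \<noteq> (N, 1) \<Longrightarrow> K w 1 = K w 0"
    "\<And>j. j \<le> N + 1 \<Longrightarrow> K (replicate j True) = (\<lambda>s. (- (c1 / \<omega>) * sin (\<omega> * s)) ^ j / fact j)"
proof -
  define a where "a = - (c1 / \<omega>)"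
  define P where "P w G \<longleftrightarrow>
      ((count_list w True, count_list w False) \<noteq> (N, 1) \<longrightarrow>
        trig N \<omega> (count_list w True) (count_list w False) G) \<and>
      (set w \<subseteq> {True} \<longrightarrow> G = (\<lambda>s. (a * sin (\<omega> * s)) ^ length w / fact (length w)))"
    for w and G :: "real \<Rightarrow> real"
  define K where "K = corrector v P"
  have "\<omega> > 0" using \<open>\<kappa> \<ge> 1\<close> by (simp add: \<omega>_def)
  have step: "(\<forall>s. (K (i # w) has_real_derivative - (v i s * K w s)) (at s)) \<and> P (i # w) (K (i # w))"
    if "P w (K w)" "length w \<le> N" "\<And>s. isCont (K w) s" for i w
  proof -
    let ?Q = "\<lambda>G. (\<forall>s. (G has_real_derivative - (v i s * K w s)) (at s)) \<and> P (i # w) G"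
    \<comment> \<open>A word of length at most \<open>N\<close> is never the resonant case
      \<open>(N, 1)\<close>, so its corrector is trigonometric.\<close>
    have tw: "trig N \<omega> (count_list w True) (count_list w False) (K w)"
      using that(1,2) length_eq_count_bool[of w] unfolding P_def by auto
    have len: "count_list (i # w) True + count_list (i # w) False \<le> N + 1"
      using that(2) length_eq_count_bool[of "i # w"] by simp
    have "\<exists>G. ?Q G"
    proof (cases "set (i # w) \<subseteq> {True}")
      case True
      define j where "j = length w"
      have w: "i" "count_list w True = j" "count_list w False = 0"
        using True length_eq_count_bool[of w] by (auto simp: j_def count_list_0_iff)
      have Kw: "K w = (\<lambda>s. (a * sin (\<omega> * s)) ^ j / fact j)"
        using that(1) True unfolding P_def j_def by auto
      let ?G = "\<lambda>s. (a * sin (\<omega> * s)) ^ Suc j / fact (Suc j)"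
      have "((\<lambda>s. a * sin (\<omega> * s)) has_real_derivative - v i s) (at s)" for s
        unfolding v_def a_def using w(1) \<open>\<omega> > 0\<close> by (auto intro!: derivative_eq_intros)
      from DERIV_power_div_fact[OF this]
      have G: "(?G has_real_derivative - (v i s * K w s)) (at s)" for s
        unfolding Kw by simp
      have "trig N \<omega> (Suc j) 0 ?G"
        using trig_cmult[OF trig_sin_power[of N \<omega> "Suc j" a], of "1 / fact (Suc j)"] by simp
      moreover have "count_list (i # w) True = Suc j" "count_list (i # w) False = 0" "length (i # w) = Suc j"
        using w by (simp_all add: j_def)
      ultimately have "P (i # w) ?G"
        unfolding P_def by presburger
      with G show ?thesis by blast
    next
      case False
      show ?thesis
      proof (cases "(count_list (i # w) True, count_list (i # w) False) = (N, 1)")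
        \<comment> \<open>Resonant words have length \<open>N + 1\<close> and are not extended
          further, so any antiderivative will do.\<close>
        case True
        have "isCont (\<lambda>s. - (v i s * K w s)) s" for s
          unfolding v_def using that(3) by (cases i) (auto intro!: continuous_intros)
        from antiderivative_exists[OF this] show ?thesis
          using True False unfolding P_def by auto
      next
        case good: False
        have even: "even (count_list (i # w) True)"
          if "0 \<in> freqs N (count_list (i # w) True) (count_list (i # w) False)"
          using zero_in_freqs_imp_even[OF \<open>odd N\<close> len good that] .
        have "\<exists>G. trig N \<omega> (count_list (i # w) True) (count_list (i # w) False) G \<and>
          (\<forall>s. (G has_real_derivative - (v i s * K w s)) (at s))"
        proof (cases i)
          case True
          then show ?thesis
            using trig_antiderivative_cos_mult[OF \<open>\<omega> > 0\<close> tw, of "- c1"] even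
            by (simp add: v_def)
        next
          case False
          then show ?thesis
            using trig_antiderivative_sin_mult[OF \<open>\<omega> > 0\<close> tw, of "- c2"] even
            by (simp add: v_def)
        qed
        then show ?thesis using False unfolding P_def by blast
      qed
    qed
    then have "?Q (SOME G. ?Q G)" by (rule someI_ex)
    then show ?thesis by (simp add: K_def)
  qed
  have main: "P w (K w) \<and> (\<forall>s. isCont (K w) s)" if "length w \<le> N + 1" for w
    using that
  proof (induction w)
    case Nil
    then show ?case by (simp add: P_def K_def trig_1)
  next
    case (Cons i w)
    then show ?case
      using step[of w i] by (auto intro: DERIV_isCont)
  qed
  show ?thesis
  proof (rule that)
    show "K [] = (\<lambda>s. 1)" by (simp add: K_def)
    show "(K (i # w) has_real_derivative - (v i s * K w s)) (at s)" if "length w \<le> N" for w i s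
      using step[of w i] main[of w] that by auto
    show "K w 1 = K w 0"
      if "length w \<le> N + 1" "(count_list w True, count_list w False) \<noteq> (N, 1)" for w
      using main[OF that(1)] that(2) trig_periodic unfolding P_def \<omega>_def by blast
    show "K (replicate j True) = (\<lambda>s. (- (c1 / \<omega>) * sin (\<omega> * s)) ^ j / fact j)" if "j \<le> N + 1" for j
    proof -
      have "set (replicate j True) \<subseteq> {True}" by auto
      then show ?thesis using main[of "replicate j True"] that unfolding P_def a_def by simp
    qed
  qed
qed

text \<open>The remaining words contain \<open>False\<close> exactly once. Repeated integration by parts, with
  \<open>V = (c\<^sub>1 / \<omega>) sin (\<omega> s)\<close> vanishing at both ends, moves all factors to the position of \<open>False\<close>.\<close>

lemma corrector_moment:
  fixes N \<kappa> :: nat and c1 c2 :: real and K :: "bool list \<Rightarrow> real \<Rightarrow> real"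
  defines "\<omega> \<equiv> 2 * pi * real \<kappa>"
  defines "v \<equiv> (\<lambda>i s. if i then c1 * cos (\<omega> * s) else c2 * sin (real N * \<omega> * s))"
  assumes "odd N" "\<kappa> \<ge> 1"
    and c12: "c1 ^ N * c2 = (4 * pi * real \<kappa>) ^ N * fact N * (-1) ^ (N div 2)"
    and Kd: "\<And>w i s. length w \<le> N \<Longrightarrow> (K (i # w) has_real_derivative - (v i s * K w s)) (at s)"
    and KT: "\<And>j. j \<le> N + 1 \<Longrightarrow> K (replicate j True) = (\<lambda>s. (- (c1 / \<omega>) * sin (\<omega> * s)) ^ j / fact j)"
    and "l \<le> N"
  defines "w \<equiv> replicate l True @ False # replicate (N - l) True"
  shows "K w 0 - K w 1 = (-1) ^ (N - l) * real (N choose l)"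
proof -
  define V where "V s = c1 / \<omega> * sin (\<omega> * s)" for s
  define j where "j = N - l"
  \<comment> \<open>\<open>W p\<close> is the corrector once \<open>p\<close> of the letters in
    front of \<open>False\<close> are attached; \<open>j\<close> letters \<open>True\<close> stand
    behind it.\<close>
  define W where "W p = K (replicate p True @ False # replicate j True)" for p
  define m where "m = (-1) ^ j * real (N choose l)"
  have "\<omega> > 0" using \<open>\<kappa> \<ge> 1\<close> by (simp add: \<omega>_def)
  have dV: "(V has_real_derivative v True s) (at s)" for s
    unfolding V_def v_def using \<open>\<omega> > 0\<close> by (auto intro!: derivative_eq_intros)
  have V0: "V 0 = 0" "V 1 = 0"
    using sin_int_2pin[of "int \<kappa>"] by (simp_all add: V_def \<omega>_def mult_ac)
  have dW0: "(W 0 has_real_derivative - (v False s * ((- V s) ^ j / fact j))) (at s)" for s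
    using Kd[of "replicate j True" False s] KT[of j] by (simp add: W_def V_def j_def)
  have dWS: "(W (Suc p) has_real_derivative - (v True s * W p s)) (at s)" if "p < l" for p s
    using Kd[of "replicate p True @ False # replicate j True" True s] that \<open>l \<le> N\<close>
    by (simp add: W_def j_def)
  \<comment> \<open>The integral left after all integrations by parts: the \<open>l\<close> letters
    before and the \<open>j\<close> letters behind \<open>False\<close> merge into
    \<open>V s ^ N\<close>, up to sign and factorials.\<close>
  have base: "((\<lambda>s. V s ^ l / fact l * (v False s * ((- V s) ^ j / fact j))) has_integral m) {0..1}"
  proof -
    have "V s ^ l / fact l * (v False s * ((- V s) ^ j / fact j)) =
        (-1) ^ j / (fact l * fact j) * (c1 / \<omega>) ^ N * c2 * (sin (\<omega> * s) ^ N * sin (real N * \<omega> * s))" for s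
    proof -
      have "V s ^ l * (- V s) ^ j = (-1) ^ j * V s ^ N"
      proof -
        have "(- V s) ^ j = (-1) ^ j * V s ^ j" by (rule power_minus)
        moreover have "V s ^ N = V s ^ l * V s ^ j"
          using \<open>l \<le> N\<close> by (simp add: j_def flip: power_add)
        ultimately show ?thesis by simp
      qed
      moreover have "A / x * (u * (B / y)) = (A * B) * u / (x * y)" for A B u x y :: real
        by simp
      ultimately have e: "V s ^ l / fact l * (v False s * ((- V s) ^ j / fact j)) =
        ((-1) ^ j * V s ^ N) * v False s / (fact l * fact j)"
        by (simp only:)
      have "V s ^ N = (c1 / \<omega>) ^ N * sin (\<omega> * s) ^ N"
        by (simp only: V_def power_mult_distrib)
      moreover have "v False s = c2 * sin (real N * \<omega> * s)" by (simp add: v_def)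
      ultimately show ?thesis
        unfolding e by (simp only: mult_ac times_divide_eq_left times_divide_eq_right)
    qed
    moreover have "m = (-1) ^ j / (fact l * fact j) * (c1 / \<omega>) ^ N * c2 * ((-1) ^ (N div 2) / 2 ^ N)"
    proof -
      \<comment> \<open>Here the amplitude condition enters: \<open>4 * pi * \<kappa>\<close> is
        \<open>2 * \<omega>\<close>, so \<open>\<omega> ^ N\<close> cancels and \<open>2 ^ N\<close>
        offsets the mean value \<open>1 / 2 ^ N\<close>.\<close>
      have "(c1 / \<omega>) ^ N * c2 = 2 ^ N * fact N * (-1) ^ (N div 2)"
      proof -
        have "4 * pi * real \<kappa> = 2 * \<omega>" by (simp add: \<omega>_def)
        then have "(4 * pi * real \<kappa>) ^ N = 2 ^ N * \<omega> ^ N"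
          by (simp only: power_mult_distrib)
        with c12 have "c1 ^ N * c2 = \<omega> ^ N * (2 ^ N * fact N * (-1) ^ (N div 2))"
          by (simp only: mult_ac)
        then show ?thesis using \<open>\<omega> > 0\<close> by (simp add: power_divide)
      qed
      then have "(c1 / \<omega>) ^ N * c2 * ((-1) ^ (N div 2) / 2 ^ N) = fact N"
        by (simp flip: power_mult_distrib)
      moreover have "real (N choose l) = fact N / (fact l * fact j)"
        using \<open>l \<le> N\<close> by (simp add: j_def binomial_fact)
      ultimately have "m = (-1) ^ j / (fact l * fact j) * ((c1 / \<omega>) ^ N * c2 * ((-1) ^ (N div 2) / 2 ^ N))"
        by (simp add: m_def)
      then show ?thesis by (simp only: mult.assoc)
    qed
    ultimately show ?thesis
      using has_integral_mult_right[OF sin_power_mult_sin_has_integral[OF \<open>\<kappa> \<ge> 1\<close> \<open>odd N\<close>],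
          of "(-1) ^ j / (fact l * fact j) * (c1 / \<omega>) ^ N * c2"]
      by (simp add: \<omega>_def)
  qed
  \<comment> \<open>\<open>q\<close> counts the factors already moved. Boundary terms vanish because
    \<open>V\<close> is zero at \<open>0\<close> and \<open>1\<close>, so each integration by parts
    keeps the value \<open>m\<close>.\<close>
  have parts: "((\<lambda>s. V s ^ q / fact q * (v True s * W p s)) has_integral m) {0..1}"
    if "q + p + 1 = l" for p q
    using that
  proof (induction p arbitrary: q)
    case 0
    then have l: "l = Suc q" by simp
    let ?H = "\<lambda>s. V s ^ l / fact l * W 0 s"
    have "(?H has_real_derivative V s ^ q / fact q * (v True s * W 0 s) -
        V s ^ l / fact l * (v False s * ((- V s) ^ j / fact j))) (at s)" for s
      using DERIV_mult[OF DERIV_power_div_fact[OF dV[of s], of q] dW0[of s]]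
      unfolding l by (simp only: mult_ac minus_mult_right[symmetric] add_uminus_conv_diff)
    from has_integral_add[OF has_integral_FTC[OF this] base] show ?case
      by (simp add: V0 l)
  next
    case (Suc p)
    let ?H = "\<lambda>s. V s ^ Suc q / fact (Suc q) * W (Suc p) s"
    have "p < l" using Suc.prems by simp
    have "(?H has_real_derivative V s ^ q / fact q * (v True s * W (Suc p) s) -
        V s ^ Suc q / fact (Suc q) * (v True s * W p s)) (at s)" for s
      by (rule DERIV_cong[OF DERIV_mult[OF DERIV_power_div_fact[OF dV[of s], of q] dWS[OF \<open>p < l\<close>, of s]]])
         algebra
    from has_integral_add[OF has_integral_FTC[OF this] Suc.IH[of "Suc q"]] show ?case
      using Suc.prems by (simp add: V0)
  qed
  have "W l 1 - W l 0 = - m"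
  proof (cases l)
    case 0
    then have "((\<lambda>s. v False s * ((- V s) ^ j / fact j)) has_integral m) {0..1}"
      using base by simp
    from has_integral_unique[OF has_integral_FTC[OF dW0] has_integral_neg[OF this]] 0
    show ?thesis by simp
  next
    case (Suc p)
    have d: "(W l has_real_derivative - (v True s * W p s)) (at s)" for s
      using dWS[of p s] Suc by simp
    have "((\<lambda>s. v True s * W p s) has_integral m) {0..1}"
      using parts[of 0 p] Suc by simp
    from has_integral_unique[OF has_integral_FTC[OF d] has_integral_neg[OF this]]
    show ?thesis .
  qed
  then show ?thesis by (simp add: W_def w_def j_def m_def)
qed

section \<open>The displacement over one period\<close>

lemma finite_lists_le: "finite {w :: 'a::finite list. length w \<le> n}"
  using finite_lists_length_le[of "UNIV :: 'a set" n] by simp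

lemma finite_lists_eq: "finite {w :: 'a::finite list. length w = n}"
  using finite_lists_length_eq[of "UNIV :: 'a set" n] by simp

text \<open>Splitting at the head isolates the derivation applied last, which makes the sums over
  words telescope.\<close>

lemma sum_lists_le_Suc:
  fixes g :: "'a::finite list \<Rightarrow> real"
  shows "(\<Sum>w | length w \<le> Suc n. g w) = g [] + (\<Sum>w | length w \<le> n. \<Sum>i\<in>UNIV. g (i # w))"
proof -
  let ?c = "\<lambda>(w, i :: 'a). i # w"
  have e: "{w :: 'a list. length w \<le> Suc n} = insert [] (?c ` ({w. length w \<le> n} \<times> UNIV))"
    (is "?A = ?B")
  proof
    show "?A \<subseteq> ?B"
    proof
      fix w :: "'a list" assume "w \<in> ?A"
      then show "w \<in> ?B" by (cases w) (auto intro!: image_eqI)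
    qed
  qed auto
  have "inj_on ?c ({w. length w \<le> n} \<times> UNIV)" by (auto simp: inj_on_def)
  then have "(\<Sum>w\<in>?c ` ({w. length w \<le> n} \<times> UNIV). g w) = (\<Sum>w | length w \<le> n. \<Sum>i\<in>UNIV. g (i # w))"
    by (simp add: sum.reindex sum.cartesian_product split_def)
  moreover have "finite (?c ` ({w. length w \<le> n} \<times> UNIV))"
    by (intro finite_imageI finite_cartesian_product finite_lists_le) simp
  ultimately show ?thesis
    unfolding e by (subst sum.insert) auto
qed

lemma sum_lists_le_Suc_last:
  fixes g :: "'a::finite list \<Rightarrow> real"
  shows "(\<Sum>w | length w \<le> Suc n. g w) = (\<Sum>w | length w \<le> n. g w) + (\<Sum>w | length w = Suc n. g w)"
proof -
  have "{w :: 'a list. length w \<le> Suc n} = {w. length w \<le> n} \<union> {w. length w = Suc n}" by auto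
  then show ?thesis by (simp add: sum.union_disjoint finite_lists_le finite_lists_eq disjoint_iff)
qed

text \<open>Bounds that may be relaxed have a common one over a finite set, their maximum. This
  gives Lipschitz and sup bounds uniform over words.\<close>

lemma finite_uniform_constant:
  assumes "finite W" "\<And>w. w \<in> W \<Longrightarrow> \<exists>C::real. Q w C"
    and mono: "\<And>w C C'. w \<in> W \<Longrightarrow> Q w C \<Longrightarrow> C \<le> C' \<Longrightarrow> Q w C'"
  shows "\<exists>C\<ge>0. \<forall>w\<in>W. Q w C"
  using assms
proof (induction W)
  case (insert x W)
  have "\<exists>C\<ge>0. \<forall>w\<in>W. Q w C"
    using insert.IH insert.prems by blast
  moreover have "\<exists>C. Q x C" using insert.prems(1) by blast
  ultimately obtain C C' where C: "C \<ge> 0" "\<forall>w\<in>W. Q w C" "Q x C'" by blast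
  then have "\<forall>w\<in>insert x W. Q w (max C C')"
    using insert.prems(2) max.cobounded1 max.cobounded2 by (metis insertE insertI1 insertI2)
  with C(1) show ?case by (intro exI[of _ "max C C'"]) auto
qed auto

lemma real_derivative_bound:
  assumes "\<And>s. s \<in> {0..1} \<Longrightarrow> (X has_real_derivative X' s) (at s within {0..1::real})"
    and "\<And>s. s \<in> {0..1} \<Longrightarrow> \<bar>X' s\<bar> \<le> B" and "s \<in> {0..1}"
  shows "\<bar>X s - X 0\<bar> \<le> B"
proof -
  have "norm (X s - X 0) \<le> B * norm (s - 0)"
    using assms by (intro field_differentiable_bound[of "{0..1}" X X']) auto
  moreover have "0 \<le> B" using assms(2)[of 0] by auto
  then have "B * s \<le> B" using assms(3) by (simp add: mult_left_le)
  ultimately show ?thesis using assms(3) by simp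
qed

text \<open>The error is bounded through the unknown displacement \<open>d\<close> itself. As
  \<open>C2 * \<eta> \<le> 1 / 2\<close>, that term can be absorbed to give
  \<open>\<bar>d\<bar> = O(e)\<close>, and inserting this yields the order
  \<open>e * \<eta>\<close>.\<close>

lemma bootstrap_estimate:
  fixes d e a \<eta> A C1 C2 :: real
  assumes "0 \<le> e" "0 < \<eta>" "\<eta> \<le> 1" "C2 * \<eta> \<le> 1 / 2" "0 \<le> C1" "0 \<le> C2"
    and "\<bar>d - e * a\<bar> \<le> C1 * e * \<eta> + C2 * \<eta> * \<bar>d\<bar>" and "\<bar>a\<bar> \<le> A"
  shows "\<bar>d - e * a\<bar> \<le> (C1 + 2 * C2 * (A + C1)) * e * \<eta>"
proof -
  have "\<bar>e * a\<bar> \<le> e * A" using assms by (simp add: abs_mult mult_left_mono)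
  moreover have "C1 * e * \<eta> \<le> C1 * e" using assms by (simp add: mult_left_le)
  moreover have "C2 * \<eta> * \<bar>d\<bar> \<le> 1 / 2 * \<bar>d\<bar>" using assms by (intro mult_right_mono) auto
  moreover have "\<bar>d\<bar> \<le> \<bar>d - e * a\<bar> + \<bar>e * a\<bar>"
    using abs_triangle_ineq[of "d - e * a" "e * a"] by simp
  moreover have "x \<le> 2 * (p + r)" if "z \<le> p" "q \<le> r" "u \<le> 1 / 2 * x" "x \<le> y + z" "y \<le> q + u"
    for p q r u x y z :: real
    using that by (simp add: field_simps)
  ultimately have "\<bar>d\<bar> \<le> 2 * (e * A + C1 * e)" using assms(7) by blast
  then have "C2 * \<eta> * \<bar>d\<bar> \<le> C2 * \<eta> * (2 * (e * A + C1 * e))"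
    using assms by (intro mult_left_mono) auto
  with assms(7) show ?thesis by (simp add: algebra_simps)
qed

text \<open>Along a solution \<open>X\<close>, the derivative of \<open>\<Sum> \<eta>\<^sup>|\<^sup>w\<^sup>| K\<^sub>w(s) h\<^sub>w(X(s))\<close>, where \<open>h\<^sub>w\<close> is the iterated
  Lie derivative of the identity, telescopes to the terms of the highest order.\<close>

lemma correctors_estimate:
  fixes f v :: "bool \<Rightarrow> real \<Rightarrow> real" and K :: "bool list \<Rightarrow> real \<Rightarrow> real"
  assumes "open D" and fC: "\<And>i. C_on (Suc N) (f i) D" and ab: "{a..b} \<subseteq> D"
    and K0: "K [] = (\<lambda>s. 1)"
    and Kd: "\<And>w i s. length w \<le> N \<Longrightarrow> (K (i # w) has_real_derivative - (v i s * K w s)) (at s)"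
    and per: "\<And>w. length w \<le> N \<Longrightarrow> K w 1 = K w 0"
    and vb: "\<And>i s. \<bar>v i s\<bar> \<le> Vb"
  defines "A \<equiv> \<lambda>x. \<Sum>w | length w = Suc N. (K w 0 - K w 1) * lie_word f w (\<lambda>x. x) x"
  shows "\<exists>C\<ge>0. \<exists>\<eta>0>0. \<forall>\<eta> X. 0 < \<eta> \<and> \<eta> \<le> \<eta>0 \<and>
    (\<forall>s\<in>{0..1}. X s \<in> {a..b} \<and>
      (X has_real_derivative \<eta> * (\<Sum>i\<in>UNIV. f i (X s) * v i s)) (at s within {0..1})) \<longrightarrow>
    \<bar>X 1 - X 0 - \<eta> ^ Suc N * A (X 0)\<bar> \<le> C * \<eta> ^ Suc N * \<eta>"
proof -
  define h where "h w = lie_word f w (\<lambda>x. x)" for w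
  \<comment> \<open>The empty word gets derivative \<open>0\<close>, in accordance with the constant
    \<open>K []\<close>.\<close>
  define K' where "K' w s = (case w of [] \<Rightarrow> 0 | i # u \<Rightarrow> - (v i s * K u s))" for w s
  have hC: "C_on 1 (h w) D" if "length w \<le> Suc N" for w
    unfolding h_def using that
    by (intro C_on_lie_word \<open>open D\<close> C_on_ident C_on_mono[OF fC]) auto
  have dK: "(K w has_real_derivative K' w s) (at s)" if "length w \<le> Suc N" for w s
    using Kd that by (cases w) (auto simp: K'_def K0)
  have "\<exists>L\<ge>0. \<forall>w\<in>{w. length w \<le> Suc N}. \<forall>x\<in>{a..b}. \<forall>y\<in>{a..b}. \<bar>h w x - h w y\<bar> \<le> L * \<bar>x - y\<bar>"
  proof (rule finite_uniform_constant[OF finite_lists_le])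
    show "\<exists>L. \<forall>x\<in>{a..b}. \<forall>y\<in>{a..b}. \<bar>h w x - h w y\<bar> \<le> L * \<bar>x - y\<bar>"
      if "w \<in> {w. length w \<le> Suc N}" for w
      using C_on_1_lipschitz[OF hC ab, of w] that by (metis mem_Collect_eq)
    show "\<forall>x\<in>{a..b}. \<forall>y\<in>{a..b}. \<bar>h w x - h w y\<bar> \<le> C' * \<bar>x - y\<bar>"
      if "\<forall>x\<in>{a..b}. \<forall>y\<in>{a..b}. \<bar>h w x - h w y\<bar> \<le> C * \<bar>x - y\<bar>" "C \<le> C'" for w C C'
      using that by (meson abs_ge_zero mult_right_mono order_trans)
  qed
  then obtain L where L0: "L \<ge> 0"
    and L: "\<And>w x y. length w \<le> Suc N \<Longrightarrow> x \<in> {a..b} \<Longrightarrow> y \<in> {a..b} \<Longrightarrow> \<bar>h w x - h w y\<bar> \<le> L * \<bar>x - y\<bar>"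
    by blast
  have KB: "\<exists>B. \<forall>s\<in>{0..1}. \<bar>K w s\<bar> \<le> B" if "w \<in> {w. length w \<le> Suc N}" for w
  proof -
    have "continuous_on {0..1} (K w)"
      using that by (intro DERIV_continuous_on[OF has_field_derivative_at_within[OF dK]]) auto
    then have "bounded (K w ` {0..1})"
      by (intro compact_imp_bounded compact_continuous_image) auto
    then show ?thesis by (metis bounded_iff image_eqI real_norm_def)
  qed
  have "\<exists>B\<ge>0. \<forall>w\<in>{w. length w \<le> Suc N}. \<forall>s\<in>{0..1}. \<bar>K w s\<bar> \<le> B"
    by (rule finite_uniform_constant[OF finite_lists_le KB]) (auto intro: order_trans)
  then obtain B where B0: "B \<ge> 0" and B: "\<And>w s. length w \<le> Suc N \<Longrightarrow> s \<in> {0..1} \<Longrightarrow> \<bar>K w s\<bar> \<le> B"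
    by blast
  have fB: "\<exists>B. \<forall>x\<in>{a..b}. \<bar>f i x\<bar> \<le> B" for i
    using C_on_bounded[OF fC ab, of i] by metis
  have "\<exists>B\<ge>0. \<forall>i\<in>UNIV. \<forall>x\<in>{a..b}. \<bar>f i x\<bar> \<le> B"
    by (rule finite_uniform_constant[OF finite fB]) (auto intro: order_trans)
  then obtain Fb where Fb0: "Fb \<ge> 0" and Fb: "\<And>i x. x \<in> {a..b} \<Longrightarrow> \<bar>f i x\<bar> \<le> Fb"
    by blast
  have Vb0: "Vb \<ge> 0" using vb[of True 0] by linarith
  define M where "M = 2 * (Fb * Vb)"
  have M: "\<bar>\<Sum>i\<in>UNIV. f i x * v i s\<bar> \<le> M" if "x \<in> {a..b}" for x s
  proof -
    have "\<bar>f i x * v i s\<bar> \<le> Fb * Vb" for i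
      unfolding abs_mult using Fb[OF that] vb Fb0 by (intro mult_mono) auto
    from this[of True] this[of False] show ?thesis
      by (simp add: M_def UNIV_bool)
  qed
  have M0: "M \<ge> 0" using Fb0 Vb0 by (simp add: M_def)
  have "continuous_on {a..b} A"
    unfolding A_def h_def[symmetric] using hC ab
    by (intro continuous_intros continuous_on_subset[OF C_on_imp_continuous_on[OF hC]]) auto
  then have "bounded (A ` {a..b})"
    by (intro compact_imp_bounded compact_continuous_image) auto
  then obtain A0 where A0: "\<And>x. x \<in> {a..b} \<Longrightarrow> \<bar>A x\<bar> \<le> A0"
    by (metis bounded_iff image_eqI real_norm_def)
  define c where "c = real (card {w :: bool list. length w = Suc N})"
  define c' where "c' = real (card {w :: bool list. length w \<le> N})"
  define C1 where "C1 = c * (Vb * B * (L * M))"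
  define C2 where "C2 = c' * (B * L)"
  have C10: "C1 \<ge> 0" and C20: "C2 \<ge> 0"
    using Vb0 B0 L0 M0 by (simp_all add: C1_def C2_def c_def c'_def)
  \<comment> \<open>Small enough for both \<open>\<eta> \<le> 1\<close> and
    \<open>C2 * \<eta> \<le> 1 / 2\<close>, as the bootstrap requires.\<close>
  define \<eta>0 where "\<eta>0 = 1 / (2 * C2 + 1)"
  have main: "\<bar>X 1 - X 0 - \<eta> ^ Suc N * A (X 0)\<bar> \<le> (C1 + 2 * C2 * (\<bar>A0\<bar> + C1)) * \<eta> ^ Suc N * \<eta>"
    if "0 < \<eta>" "\<eta> \<le> \<eta>0" and Xab: "\<And>s. s \<in> {0..1} \<Longrightarrow> X s \<in> {a..b}"
      and dX: "\<And>s. s \<in> {0..1} \<Longrightarrow>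
        (X has_real_derivative \<eta> * (\<Sum>i\<in>UNIV. f i (X s) * v i s)) (at s within {0..1})" for \<eta> X
  proof -
    have "\<eta> * (2 * C2 + 1) \<le> 1"
      using \<open>\<eta> \<le> \<eta>0\<close> C20 by (simp add: \<eta>0_def field_simps)
    moreover have "\<eta> * (2 * C2 + 1) = 2 * (C2 * \<eta>) + \<eta>" by (simp add: algebra_simps)
    moreover have "0 \<le> C2 * \<eta>" using C20 \<open>0 < \<eta>\<close> by simp
    ultimately have \<eta>: "\<eta> \<le> 1" "C2 * \<eta> \<le> 1 / 2"
      using \<open>0 < \<eta>\<close> by linarith+
    define F where "F s = (\<Sum>i\<in>UNIV. f i (X s) * v i s)" for s
    define \<Psi> where "\<Psi> s = (\<Sum>w | length w \<le> N. \<eta> ^ length w * (K w s * h w (X s))) +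
      (\<Sum>w | length w = Suc N. \<eta> ^ Suc N * (K w s * h w (X 0)))" for s
    define R where "R s = (\<Sum>w | length w = Suc N. \<eta> ^ Suc N * (K' w s * (h w (X 0) - h w (X s))))" for s
    have Xs: "\<bar>X s - X 0\<bar> \<le> \<eta> * M" if "s \<in> {0..1}" for s
    proof (rule real_derivative_bound[OF dX _ that])
      fix s :: real assume "s \<in> {0..1}"
      then show "\<bar>\<eta> * (\<Sum>i\<in>UNIV. f i (X s) * v i s)\<bar> \<le> \<eta> * M"
        using M[OF Xab] \<open>0 < \<eta>\<close> unfolding abs_mult by (intro mult_mono) auto
    qed
    have d\<Psi>: "(\<Psi> has_real_derivative R s) (at s within {0..1})" if s: "s \<in> {0..1}" for s
    proof -
      have dh: "((\<lambda>s. h w (X s)) has_real_derivative deriv (h w) (X s) * (\<eta> * F s)) (at s within {0..1})"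
        if "length w \<le> Suc N" for w
        unfolding F_def using C_on_has_derivative[OF hC[OF that]] Xab[OF s] ab
        by (intro DERIV_chain2[OF _ dX[OF s]]) auto
      have dK': "(K w has_real_derivative K' w s) (at s within {0..1})" if "length w \<le> Suc N" for w
        using dK[OF that] by (rule has_field_derivative_at_within)
      have 1: "(\<Psi> has_real_derivative
          (\<Sum>w | length w \<le> N. \<eta> ^ length w * (K' w s * h w (X s) + (deriv (h w) (X s) * (\<eta> * F s)) * K w s)) +
          (\<Sum>w | length w = Suc N. \<eta> ^ Suc N * (K' w s * h w (X 0)))) (at s within {0..1})"
        unfolding \<Psi>_def
        by (intro DERIV_add DERIV_sum DERIV_cmult DERIV_mult DERIV_cmult_right dK' dh) auto
      \<comment> \<open>The telescoping: the chain rule for \<open>h w\<close> produces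
        \<open>h (i # w)\<close> with weight \<open>v i s * K w s\<close>, which is
        \<open>- K' (i # w) s\<close>.\<close>
      have "(\<Sum>w | length w \<le> Suc N. \<eta> ^ length w * (K' w s * h w (X s))) =
          (\<Sum>w | length w \<le> N. \<Sum>i\<in>UNIV. \<eta> ^ Suc (length w) * (K' (i # w) s * h (i # w) (X s)))"
        unfolding sum_lists_le_Suc by (simp add: K'_def)
      also have "\<dots> = - (\<Sum>w | length w \<le> N. \<eta> ^ length w * ((deriv (h w) (X s) * (\<eta> * F s)) * K w s))"
        unfolding sum_negf[symmetric]
        by (intro sum.cong refl) (simp add: K'_def h_def F_def UNIV_bool algebra_simps)
      finally have 2: "(\<Sum>w | length w \<le> N. \<eta> ^ length w * ((deriv (h w) (X s) * (\<eta> * F s)) * K w s)) =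
          - (\<Sum>w | length w \<le> N. \<eta> ^ length w * (K' w s * h w (X s))) -
            (\<Sum>w | length w = Suc N. \<eta> ^ length w * (K' w s * h w (X s)))"
        unfolding sum_lists_le_Suc_last by linarith
      have 3: "(\<Sum>w | length w = Suc N. \<eta> ^ length w * (K' w s * h w (X s))) =
          (\<Sum>w | length w = Suc N. \<eta> ^ Suc N * (K' w s * h w (X s)))"
        by (intro sum.cong) auto
      have "(\<Sum>w | length w \<le> N. \<eta> ^ length w * (K' w s * h w (X s) + (deriv (h w) (X s) * (\<eta> * F s)) * K w s)) +
          (\<Sum>w | length w = Suc N. \<eta> ^ Suc N * (K' w s * h w (X 0))) = R s"
        unfolding R_def distrib_left sum.distrib 2 3 right_diff_distrib sum_subtractf by simp
      with 1 show ?thesis by simp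
    qed
    have Rb: "\<bar>R s\<bar> \<le> C1 * \<eta> ^ Suc N * \<eta>" if s: "s \<in> {0..1}" for s
    proof -
      have "\<bar>R s\<bar> \<le> (\<Sum>w | length w = Suc N. \<bar>\<eta> ^ Suc N * (K' w s * (h w (X 0) - h w (X s)))\<bar>)"
        unfolding R_def by (rule sum_abs)
      also have "\<dots> \<le> (\<Sum>w :: bool list | length w = Suc N. \<eta> ^ Suc N * ((Vb * B) * (L * (\<eta> * M))))"
      proof (rule sum_mono)
        fix w :: "bool list" assume w: "w \<in> {w. length w = Suc N}"
        then obtain i u where u: "w = i # u" "length u = N" by (cases w) auto
        have "\<bar>K' w s\<bar> \<le> Vb * B"
          using vb[of i s] B[of u s] Vb0 s u by (auto simp: K'_def abs_mult intro!: mult_mono)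
        moreover have "\<bar>h w (X 0) - h w (X s)\<bar> \<le> L * (\<eta> * M)"
        proof -
          have "\<bar>h w (X 0) - h w (X s)\<bar> \<le> L * \<bar>X 0 - X s\<bar>"
            using w s by (intro L Xab) auto
          also have "\<dots> \<le> L * (\<eta> * M)"
            using Xs[OF s] L0 by (intro mult_left_mono) auto
          finally show ?thesis .
        qed
        ultimately show "\<bar>\<eta> ^ Suc N * (K' w s * (h w (X 0) - h w (X s)))\<bar> \<le>
            \<eta> ^ Suc N * ((Vb * B) * (L * (\<eta> * M)))"
          using \<open>0 < \<eta>\<close> Vb0 B0 unfolding abs_mult by (intro mult_mono) auto
      qed
      also have "\<dots> = C1 * \<eta> ^ Suc N * \<eta>"
        by (simp add: C1_def c_def)
      finally show ?thesis .
    qed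
    have "\<bar>\<Psi> 1 - \<Psi> 0\<bar> \<le> C1 * \<eta> ^ Suc N * \<eta>"
      by (rule real_derivative_bound[OF d\<Psi> Rb]) auto
    moreover
    \<comment> \<open>\<open>S\<close> collects the nonempty words up to length \<open>N\<close>,
      each with at least one factor \<open>\<eta>\<close>; the empty word contributes
      \<open>X 1 - X 0\<close> itself.\<close>
    define S where "S = (\<Sum>w\<in>{w. length w \<le> N} - {[]}. \<eta> ^ length w * (K w 0 * (h w (X 1) - h w (X 0))))"
    have "\<Psi> 1 - \<Psi> 0 = (X 1 - X 0) + S - \<eta> ^ Suc N * A (X 0)"
    proof -
      have "(\<Sum>w | length w \<le> N. \<eta> ^ length w * (K w 1 * h w (X 1))) -
          (\<Sum>w | length w \<le> N. \<eta> ^ length w * (K w 0 * h w (X 0))) =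
          (\<Sum>w | length w \<le> N. \<eta> ^ length w * (K w 0 * (h w (X 1) - h w (X 0))))"
        unfolding sum_subtractf[symmetric]
        by (intro sum.cong refl) (simp add: per algebra_simps)
      also have "\<dots> = (X 1 - X 0) + S"
        unfolding S_def by (subst sum.remove[of _ "[]"]) (auto simp: finite_lists_le K0 h_def)
      finally have "(\<Sum>w | length w \<le> N. \<eta> ^ length w * (K w 1 * h w (X 1))) -
          (\<Sum>w | length w \<le> N. \<eta> ^ length w * (K w 0 * h w (X 0))) = (X 1 - X 0) + S" .
      moreover have "(\<Sum>w | length w = Suc N. \<eta> ^ Suc N * (K w 1 * h w (X 0))) -
          (\<Sum>w | length w = Suc N. \<eta> ^ Suc N * (K w 0 * h w (X 0))) = - (\<eta> ^ Suc N * A (X 0))"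
        unfolding sum_subtractf[symmetric] A_def sum_distrib_left sum_negf[symmetric]
        by (intro sum.cong refl) (simp add: h_def algebra_simps)
      ultimately show ?thesis unfolding \<Psi>_def by linarith
    qed
    moreover have "\<bar>S\<bar> \<le> C2 * \<eta> * \<bar>X 1 - X 0\<bar>"
    proof -
      have "\<bar>S\<bar> \<le> (\<Sum>w\<in>{w. length w \<le> N} - {[]}. \<bar>\<eta> ^ length w * (K w 0 * (h w (X 1) - h w (X 0)))\<bar>)"
        unfolding S_def by (rule sum_abs)
      also have "\<dots> \<le> (\<Sum>w\<in>{w :: bool list. length w \<le> N} - {[]}. \<eta> * (B * (L * \<bar>X 1 - X 0\<bar>)))"
      proof (rule sum_mono)
        fix w :: "bool list" assume w: "w \<in> {w. length w \<le> N} - {[]}"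
        then have "\<eta> ^ length w \<le> \<eta> ^ 1"
          using \<open>0 < \<eta>\<close> \<eta>(1) by (intro power_decreasing) (auto simp: Suc_le_eq)
        moreover have "\<bar>K w 0\<bar> \<le> B" "\<bar>h w (X 1) - h w (X 0)\<bar> \<le> L * \<bar>X 1 - X 0\<bar>"
          using w by (auto intro!: B L Xab)
        ultimately show "\<bar>\<eta> ^ length w * (K w 0 * (h w (X 1) - h w (X 0)))\<bar> \<le> \<eta> * (B * (L * \<bar>X 1 - X 0\<bar>))"
          using \<open>0 < \<eta>\<close> B0 unfolding abs_mult by (intro mult_mono) auto
      qed
      also have "\<dots> \<le> (\<Sum>w :: bool list | length w \<le> N. \<eta> * (B * (L * \<bar>X 1 - X 0\<bar>)))"
        using \<open>0 < \<eta>\<close> B0 L0 by (intro sum_mono2 finite_lists_le) auto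
      also have "\<dots> = C2 * \<eta> * \<bar>X 1 - X 0\<bar>"
        by (simp add: C2_def c'_def)
      finally show ?thesis .
    qed
    ultimately have "\<bar>X 1 - X 0 - \<eta> ^ Suc N * A (X 0)\<bar> \<le>
        C1 * \<eta> ^ Suc N * \<eta> + C2 * \<eta> * \<bar>X 1 - X 0\<bar>" by linarith
    then show ?thesis
      using \<open>0 < \<eta>\<close> \<eta> C10 C20 A0[OF Xab[of 0]] by (intro bootstrap_estimate) auto
  qed
  have "\<eta>0 > 0" "C1 + 2 * C2 * (\<bar>A0\<bar> + C1) \<ge> 0" using C10 C20 by (simp_all add: \<eta>0_def)
  with main show ?thesis by blast
qed

section \<open>Identification of the averaged field\<close>

lemma bool_list_count_False_1:
  assumes "count_list w False = 1"
  obtains l j where "w = replicate l True @ False # replicate j True"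
proof -
  have "False \<in> set w" using assms by (metis count_notin zero_neq_one)
  then obtain u u' where w: "w = u @ False # u'" "False \<notin> set u"
    by (meson split_list_first)
  moreover have "False \<notin> set u'"
    using assms w by (auto simp: count_list_0_iff)
  ultimately have "u = replicate (length u) True" "u' = replicate (length u') True"
    by (metis (full_types) replicate_length_same)+
  with w that show ?thesis by metis
qed

lemma sinusoid_bound: "\<bar>if i then c1 * cos x else c2 * sin y\<bar> \<le> \<bar>c1\<bar> + \<bar>c2 :: real\<bar>"
proof -
  have "\<bar>c1 * cos x\<bar> \<le> \<bar>c1\<bar>" "\<bar>c2 * sin y\<bar> \<le> \<bar>c2\<bar>"
    by (simp_all add: abs_mult mult_left_le)
  then show ?thesis
    using abs_ge_zero[of c1] abs_ge_zero[of c2] by auto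
qed

text \<open>Among the words of length \<open>N + 1\<close>, only those with a single
  \<open>False\<close> can have nonperiodic correctors. Their endpoint differences are the signed
  binomial coefficients in the expansion of \<open>ad_pow\<close>, so the leading term of
  \<open>correctors_estimate\<close> is the iterated bracket.\<close>

lemma averaging_estimate:
  fixes f :: "bool \<Rightarrow> real \<Rightarrow> real" and N \<kappa> :: nat and c1 c2 :: real
  defines "\<omega> \<equiv> 2 * pi * real \<kappa>"
  defines "v \<equiv> (\<lambda>i s. if i then c1 * cos (\<omega> * s) else c2 * sin (real N * \<omega> * s))"
  assumes "odd N" "\<kappa> \<ge> 1"
    and c12: "c1 ^ N * c2 = (4 * pi * real \<kappa>) ^ N * fact N * (-1) ^ (N div 2)"
    and "open D" and fC: "\<And>i. C_on (Suc N) (f i) D" and ab: "{a..b} \<subseteq> D"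
  shows "\<exists>C\<ge>0. \<exists>\<eta>0>0. \<forall>\<eta> X. 0 < \<eta> \<and> \<eta> \<le> \<eta>0 \<and>
    (\<forall>s\<in>{0..1}. X s \<in> {a..b} \<and>
      (X has_real_derivative \<eta> * (\<Sum>i\<in>UNIV. f i (X s) * v i s)) (at s within {0..1})) \<longrightarrow>
    \<bar>X 1 - X 0 - \<eta> ^ Suc N * ad_pow (f True) N (f False) (X 0)\<bar> \<le> C * \<eta> ^ Suc N * \<eta>"
proof -
  obtain K where K0: "K [] = (\<lambda>s. 1)"
    and Kd: "\<And>w i s. length w \<le> N \<Longrightarrow> (K (i # w) has_real_derivative - (v i s * K w s)) (at s)"
    and per: "\<And>w. length w \<le> N + 1 \<Longrightarrow> (count_list w True, count_list w False) \<noteq> (N, 1) \<Longrightarrow> K w 1 = K w 0"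
    and KT: "\<And>j. j \<le> N + 1 \<Longrightarrow> K (replicate j True) = (\<lambda>s. (- (c1 / \<omega>) * sin (\<omega> * s)) ^ j / fact j)"
    using correctors_exist[OF \<open>odd N\<close> \<open>\<kappa> \<ge> 1\<close>, of c1 c2] unfolding v_def \<omega>_def by blast
  define h where "h w = lie_word f w (\<lambda>x. x)" for w
  define W where "W l = replicate l True @ False # replicate (N - l) True" for l
  have mom: "K (W l) 0 - K (W l) 1 = (-1) ^ (N - l) * real (N choose l)" if "l \<le> N" for l
    unfolding W_def
    by (rule corrector_moment[OF \<open>odd N\<close> \<open>\<kappa> \<ge> 1\<close> c12])
       (rule Kd[unfolded v_def \<omega>_def] KT[unfolded \<omega>_def] that | assumption)+
  have ad: "(\<Sum>w | length w = Suc N. (K w 0 - K w 1) * h w x) = ad_pow (f True) N (f False) x"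
    if "x \<in> D" for x
  proof -
    have inj: "inj_on W {..N}"
    proof (rule inj_onI)
      fix l l' assume "W l = W l'"
      \<comment> \<open>The number of leading letters \<open>True\<close> recovers
        \<open>l\<close>.\<close>
      moreover have "length (takeWhile id (replicate n True @ False # w)) = n" for n w
        by (induction n) auto
      ultimately show "l = l'" unfolding W_def by metis
    qed
    have "(\<Sum>w | length w = Suc N. (K w 0 - K w 1) * h w x) = (\<Sum>w\<in>W ` {..N}. (K w 0 - K w 1) * h w x)"
    proof (intro sum.mono_neutral_right ballI finite_lists_eq)
      show "W ` {..N} \<subseteq> {w. length w = Suc N}" by (auto simp: W_def)
      fix w assume w: "w \<in> {w. length w = Suc N} - W ` {..N}"
      have "count_list w False \<noteq> 1"
      proof
        assume "count_list w False = 1"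
        then obtain l j where lj: "w = replicate l True @ False # replicate j True"
          by (rule bool_list_count_False_1)
        with w have "w = W l" "l \<le> N" by (auto simp: W_def)
        with w show False by blast
      qed
      then show "(K w 0 - K w 1) * h w x = 0" using per[of w] w by simp
    qed
    also have "\<dots> = (\<Sum>l\<le>N. (-1) ^ (N - l) * real (N choose l) * h (W l) x)"
      using inj mom by (simp add: sum.reindex)
    also have "\<dots> = ad_pow (f True) N (f False) x"
      using ad_pow_as_lie_words[where f=f, OF \<open>open D\<close> C_on_ident C_on_mono[OF fC] that, of N]
      by (simp add: h_def W_def)
    finally show ?thesis .
  qed
  have vb: "\<bar>v i s\<bar> \<le> \<bar>c1\<bar> + \<bar>c2\<bar>" for i s
    unfolding v_def by (rule sinusoid_bound)
  have per': "K w 1 = K w 0" if "length w \<le> N" for w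
    using per[of w] length_eq_count_bool[of w] that by auto
  have "\<exists>C\<ge>0. \<exists>\<eta>0>0. \<forall>\<eta> X. 0 < \<eta> \<and> \<eta> \<le> \<eta>0 \<and>
    (\<forall>s\<in>{0..1}. X s \<in> {a..b} \<and>
      (X has_real_derivative \<eta> * (\<Sum>i\<in>UNIV. f i (X s) * v i s)) (at s within {0..1})) \<longrightarrow>
    \<bar>X 1 - X 0 - \<eta> ^ Suc N * (\<Sum>w | length w = Suc N. (K w 0 - K w 1) * h w (X 0))\<bar> \<le> C * \<eta> ^ Suc N * \<eta>"
    unfolding h_def
    by (rule correctors_estimate[where f=f and v=v and K=K, OF \<open>open D\<close> fC ab K0]) (rule Kd per' vb | assumption)+
  then obtain C \<eta>0 where "C \<ge> 0" "\<eta>0 > 0" and *: "\<forall>\<eta> X. 0 < \<eta> \<and> \<eta> \<le> \<eta>0 \<and>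
    (\<forall>s\<in>{0..1}. X s \<in> {a..b} \<and>
      (X has_real_derivative \<eta> * (\<Sum>i\<in>UNIV. f i (X s) * v i s)) (at s within {0..1})) \<longrightarrow>
    \<bar>X 1 - X 0 - \<eta> ^ Suc N * (\<Sum>w | length w = Suc N. (K w 0 - K w 1) * h w (X 0))\<bar> \<le> C * \<eta> ^ Suc N * \<eta>"
    by (elim exE conjE) (rule that; assumption)
  have "\<bar>X 1 - X 0 - \<eta> ^ Suc N * ad_pow (f True) N (f False) (X 0)\<bar> \<le> C * \<eta> ^ Suc N * \<eta>"
    if "0 < \<eta> \<and> \<eta> \<le> \<eta>0 \<and> (\<forall>s\<in>{0..1}. X s \<in> {a..b} \<and>
      (X has_real_derivative \<eta> * (\<Sum>i\<in>UNIV. f i (X s) * v i s)) (at s within {0..1}))" for \<eta> X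
  proof -
    have "X 0 \<in> D" using that ab by auto
    from *[rule_format, OF that] show ?thesis unfolding ad[OF \<open>X 0 \<in> D\<close>] .
  qed
  with \<open>C \<ge> 0\<close> \<open>\<eta>0 > 0\<close> show ?thesis by blast
qed

section \<open>The order of the minimum\<close>

text \<open>Letting \<open>h\<close> tend to \<open>0\<close> gives \<open>a 0 = 0\<close>; dividing
  by \<open>h\<close> leaves the same situation with one coefficient fewer.\<close>

lemma vanishing_coefficients:
  fixes a :: "nat \<Rightarrow> real"
  assumes "e > 0" "\<And>h. 0 < \<bar>h\<bar> \<Longrightarrow> \<bar>h\<bar> < e \<Longrightarrow> \<bar>\<Sum>k<n. a k * h ^ k\<bar> \<le> C * \<bar>h\<bar> ^ n" "k < n"
  shows "a k = 0"
  using assms(2,3)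
proof (induction n arbitrary: a k)
  case (Suc n)
  let ?q = "\<lambda>h. \<Sum>k<n. a (Suc k) * h ^ k"
  have split: "(\<Sum>k<Suc n. a k * h ^ k) = a 0 + h * ?q h" for h
    unfolding sum.lessThan_Suc_shift sum_distrib_left by (simp add: mult_ac)
  have ev: "eventually (\<lambda>h. 0 < \<bar>h\<bar> \<and> \<bar>h\<bar> < e) (at (0::real))"
    unfolding eventually_at using \<open>e > 0\<close> by (intro exI[of _ e]) (auto simp: dist_real_def)
  have a0: "a 0 = 0"
  proof -
    have "((\<lambda>h. C * \<bar>h\<bar> ^ Suc n) \<longlongrightarrow> C * \<bar>0\<bar> ^ Suc n) (at 0)"
      "((\<lambda>h. \<bar>a 0 + h * ?q h\<bar>) \<longlongrightarrow> \<bar>a 0 + 0 * ?q 0\<bar>) (at 0)"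
      by (intro tendsto_intros)+
    moreover have "eventually (\<lambda>h. \<bar>a 0 + h * ?q h\<bar> \<le> C * \<bar>h\<bar> ^ Suc n) (at 0)"
      using ev by eventually_elim (use Suc.prems(1) split in auto)
    ultimately have "\<bar>a 0 + 0 * ?q 0\<bar> \<le> C * \<bar>0\<bar> ^ Suc n"
      by (intro tendsto_le[OF trivial_limit_at]) auto
    then show ?thesis by simp
  qed
  have q: "\<bar>?q h\<bar> \<le> C * \<bar>h\<bar> ^ n" if "0 < \<bar>h\<bar>" "\<bar>h\<bar> < e" for h
  proof -
    have "\<bar>h\<bar> * \<bar>?q h\<bar> \<le> \<bar>h\<bar> * (C * \<bar>h\<bar> ^ n)"
      using Suc.prems(1)[OF that] unfolding split a0 by (simp add: abs_mult mult_ac)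
    with that(1) show ?thesis by (simp only: mult_le_cancel_left_pos)
  qed
  have "a (Suc k) = 0" if "k < n" for k
    using Suc.IH[of "\<lambda>k. a (Suc k)", OF _ that] q by blast
  with a0 Suc.prems(2) show ?case by (cases k) auto
qed simp

text \<open>By the growth conditions, \<open>J - J\<^sup>*\<close> equals the Taylor remainder of order \<open>m - 1\<close> at
  the minimum, whose sign left of the minimum would be wrong for odd \<open>m\<close>.\<close>

lemma order_of_minimum_even:
  assumes "open D" "xs \<in> D" "m \<ge> 2" "C_on m J D"
    and gt: "\<forall>x\<in>D - {xs}. J x > Js"
    and growth: "\<forall>x\<in>D. \<alpha>1 * \<bar>x - xs\<bar> ^ m \<le> J x - Js \<and> J x - Js \<le> \<alpha>2 * \<bar>x - xs\<bar> ^ m"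
    and pos: "\<alpha>2 > 0" "\<beta>1 > 0" "\<beta>2 > 0"
    and sgn: "\<forall>x\<in>D. (deriv ^^ (m - 1)) J x * (x - xs) \<ge> \<beta>1 * \<bar>x - xs\<bar>\<^sup>2"
    and lin: "\<forall>x\<in>D. \<bar>(deriv ^^ (m - 1)) J x\<bar> \<le> \<beta>2 * \<bar>x - xs\<bar>"
  shows "odd (m - 1)"
proof
  assume even: "even (m - 1)"
  define n where "n = m - 1"
  have n: "0 < n" "m = Suc n" using \<open>m \<ge> 2\<close> by (auto simp: n_def)
  have Jxs: "J xs = Js" using growth \<open>xs \<in> D\<close> n by force
  from \<open>open D\<close> \<open>xs \<in> D\<close> obtain e' where e': "e' > 0" "ball xs e' \<subseteq> D"
    by (meson openE)
  \<comment> \<open>The radius is at most \<open>1\<close>, so that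
    \<open>\<bar>h\<bar> ^ m \<le> \<bar>h\<bar> ^ n\<close> and
    \<open>\<bar>t\<bar> \<le> fact n\<close> below.\<close>
  define e where "e = min e' 1"
  have e: "e > 0" "e \<le> 1" using e' by (auto simp: e_def)
  have inD: "xs + h \<in> D" if "\<bar>h\<bar> < e" for h
    using that e'(2) by (force simp: e_def dist_real_def)
  \<comment> \<open>The constant coefficient is set to zero because \<open>J xs = Js\<close> is
    subtracted from the expansion.\<close>
  define a where "a k = (if k = 0 then 0 else (deriv ^^ k) J xs / fact k)" for k
  have taylor: "\<exists>t. (if h < 0 then h < t \<and> t < 0 else 0 < t \<and> t < h) \<and>
      J (xs + h) - Js = (\<Sum>k<n. a k * h ^ k) + (deriv ^^ n) J (xs + t) / fact n * h ^ n"
    if h: "0 < \<bar>h\<bar>" "\<bar>h\<bar> < e" for h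
  proof -
    have "\<exists>t. (if xs + h < xs then xs + h < t \<and> t < xs else xs < t \<and> t < xs + h) \<and>
      J (xs + h) = (\<Sum>k<n. (deriv ^^ k) J xs / fact k * (xs + h - xs) ^ k) +
        (deriv ^^ n) J t / fact n * (xs + h - xs) ^ n"
    proof (rule Taylor[where a="xs - \<bar>h\<bar>" and b="xs + \<bar>h\<bar>"])
      show "\<forall>k t. k < n \<and> xs - \<bar>h\<bar> \<le> t \<and> t \<le> xs + \<bar>h\<bar> \<longrightarrow>
          ((deriv ^^ k) J has_real_derivative (deriv ^^ Suc k) J t) (at t)"
      proof (intro allI impI)
        fix k t assume *: "k < n \<and> xs - \<bar>h\<bar> \<le> t \<and> t \<le> xs + \<bar>h\<bar>"
        then have "t \<in> D" using inD[of "t - xs"] h by auto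
        with \<open>C_on m J D\<close> * n have "(deriv ^^ k) J differentiable (at t)"
          by (auto simp: C_on_def)
        then show "((deriv ^^ k) J has_real_derivative (deriv ^^ Suc k) J t) (at t)"
          by (simp add: DERIV_deriv_iff_real_differentiable)
      qed
    qed (use h n in auto)
    then obtain t where t: "if h < 0 then xs + h < t \<and> t < xs else xs < t \<and> t < xs + h"
      "J (xs + h) = (\<Sum>k<n. (deriv ^^ k) J xs / fact k * h ^ k) + (deriv ^^ n) J t / fact n * h ^ n"
      by auto
    have "(\<Sum>k<n. (deriv ^^ k) J xs / fact k * h ^ k) = Js + (\<Sum>k<n. a k * h ^ k)"
    proof -
      from n obtain n' where "n = Suc n'" by (cases n) auto
      then show ?thesis by (simp add: sum.lessThan_Suc_shift a_def Jxs del: sum.lessThan_Suc)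
    qed
    with t show ?thesis by (intro exI[of _ "t - xs"]) (auto split: if_splits)
  qed
  \<comment> \<open>\<open>J - Js\<close> and the Taylor remainder are both
    \<open>O(\<bar>h\<bar> ^ n)\<close>, hence so is the Taylor polynomial, and its coefficients
    vanish.\<close>
  have a0: "a k = 0" if "k < n" for k
  proof (rule vanishing_coefficients[OF e(1) _ that])
    fix h :: real assume h: "0 < \<bar>h\<bar>" "\<bar>h\<bar> < e"
    from taylor[OF h] obtain t where t: "if h < 0 then h < t \<and> t < 0 else 0 < t \<and> t < h"
      and eq: "J (xs + h) - Js = (\<Sum>k<n. a k * h ^ k) + (deriv ^^ n) J (xs + t) / fact n * h ^ n" by blast
    have t': "\<bar>t\<bar> < e" using t h by (auto split: if_splits)
    have "\<bar>J (xs + h) - Js\<bar> \<le> \<alpha>2 * \<bar>h\<bar> ^ n"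
    proof -
      have "J (xs + h) > Js" using gt inD[OF h(2)] h by auto
      then have "\<bar>J (xs + h) - Js\<bar> \<le> \<alpha>2 * \<bar>h\<bar> ^ m"
        using growth inD[OF h(2)] by fastforce
      also have "\<dots> \<le> \<alpha>2 * \<bar>h\<bar> ^ n"
        using h e pos n by (intro mult_left_mono power_decreasing) auto
      finally show ?thesis .
    qed
    moreover have "\<bar>(deriv ^^ n) J (xs + t) / fact n * h ^ n\<bar> \<le> \<beta>2 * \<bar>h\<bar> ^ n"
    proof -
      have "\<bar>(deriv ^^ n) J (xs + t)\<bar> \<le> \<beta>2 * \<bar>t\<bar>"
        using lin inD[OF t'] by (auto simp: n_def)
      also have "\<dots> \<le> \<beta>2 * fact n"
      proof (intro mult_left_mono)
        have "(1::real) \<le> fact n" by simp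
        then show "\<bar>t\<bar> \<le> fact n" using t' e by linarith
      qed (use pos in auto)
      finally have "\<bar>(deriv ^^ n) J (xs + t) / fact n\<bar> \<le> \<beta>2"
        by (simp add: field_simps)
      then show ?thesis unfolding abs_mult power_abs by (intro mult_right_mono) auto
    qed
    ultimately show "\<bar>\<Sum>k<n. a k * h ^ k\<bar> \<le> (\<alpha>2 + \<beta>2) * \<bar>h\<bar> ^ n"
      using eq unfolding distrib_right by linarith
  qed
  \<comment> \<open>A point left of the minimum: the intermediate point \<open>xs + t\<close> lies
    left of it too, so the derivative of order \<open>n\<close> is negative there, while
    \<open>h ^ n > 0\<close> for even \<open>n\<close>.\<close>
  define h where "h = - e / 2"
  have h: "0 < \<bar>h\<bar>" "\<bar>h\<bar> < e" "h < 0" using e by (auto simp: h_def)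
  from taylor[OF h(1,2)] h(3) obtain t where t: "h < t" "t < 0"
    and eq: "J (xs + h) - Js = (deriv ^^ n) J (xs + t) / fact n * h ^ n"
    using a0 by auto
  have "xs + t \<in> D" using t h by (intro inD) auto
  with sgn have "(deriv ^^ n) J (xs + t) * t \<ge> \<beta>1 * \<bar>t\<bar>\<^sup>2"
    by (force simp: n_def)
  moreover have "\<beta>1 * \<bar>t\<bar>\<^sup>2 > 0" using pos t by simp
  ultimately have "(deriv ^^ n) J (xs + t) < 0"
    using t(2) by (smt (verit) mult_nonneg_nonpos)
  moreover have "h ^ n > 0" using even h by (simp add: n_def zero_less_power_eq)
  ultimately have "J (xs + h) - Js < 0"
    unfolding eq by (intro mult_neg_pos) (simp_all add: divide_neg_pos)
  moreover have "J (xs + h) > Js" using gt inD[OF h(2)] h by auto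
  ultimately show False by simp
qed

section \<open>Global solutions of ordinary differential equations\<close>

text \<open>Gronwall argument: the squared difference, weighted by
  \<open>exp (- (2 * L * s))\<close>, is nonincreasing and starts at zero.\<close>

lemma ode_unique:
  fixes F :: "real \<Rightarrow> real \<Rightarrow> real"
  assumes "0 \<le> t"
    and x: "\<And>s. s \<in> {0..t} \<Longrightarrow> x s \<in> K \<and> (x has_real_derivative F s (x s)) (at s within {0..t})"
    and y: "\<And>s. s \<in> {0..t} \<Longrightarrow> y s \<in> K \<and> (y has_real_derivative F s (y s)) (at s within {0..t})"
    and lip: "\<And>s u v. s \<in> {0..t} \<Longrightarrow> u \<in> K \<Longrightarrow> v \<in> K \<Longrightarrow> \<bar>F s u - F s v\<bar> \<le> L * \<bar>u - v\<bar>"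
    and "x 0 = y 0"
  shows "x t = y t"
proof (cases "t = 0")
  case False
  with \<open>0 \<le> t\<close> have "0 < t" by simp
  define w where "w s = (x s - y s)\<^sup>2 * exp (- (2 * L * s))" for s
  define w' where "w' s = (2 * ((x s - y s) * (F s (x s) - F s (y s))) - 2 * (L * (x s - y s)\<^sup>2)) *
    exp (- (2 * L * s))" for s
  have dw: "(w has_real_derivative w' s) (at s within {0..t})" if "s \<in> {0..t}" for s
    unfolding w_def w'_def
    by (rule derivative_eq_intros conjunct2[OF x[OF that]] conjunct2[OF y[OF that]] refl)+
       (simp add: algebra_simps power2_eq_square)
  have "w t \<le> w 0"
  proof (rule DERIV_nonpos_imp_decreasing_open[OF \<open>0 \<le> t\<close>])
    fix s assume s: "0 < s" "s < t"
    then have "(x s - y s) * (F s (x s) - F s (y s)) \<le> L * (x s - y s)\<^sup>2"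
    proof -
      have "(x s - y s) * (F s (x s) - F s (y s)) \<le> \<bar>x s - y s\<bar> * \<bar>F s (x s) - F s (y s)\<bar>"
        by (metis abs_ge_self abs_mult)
      also have "\<dots> \<le> \<bar>x s - y s\<bar> * (L * \<bar>x s - y s\<bar>)"
        using x[of s] y[of s] lip[of s "x s" "y s"] s by (intro mult_left_mono) auto
      finally show ?thesis by (simp add: power2_eq_square mult.left_commute)
    qed
    then have "w' s \<le> 0" unfolding w'_def by (intro mult_nonpos_nonneg) (simp_all only: diff_le_0_iff_le mult_le_cancel_left_pos exp_ge_zero zero_less_numeral)
    moreover have "(w has_real_derivative w' s) (at s)"
      using dw[of s] s by (simp add: at_within_Icc_at)
    ultimately show "\<exists>y. (w has_real_derivative y) (at s) \<and> y \<le> 0" by blast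
  next
    show "continuous_on {0..t} w"
      using dw by (rule DERIV_continuous_on)
  qed
  also have "w 0 = 0" using \<open>x 0 = y 0\<close> by (simp add: w_def)
  finally have "(x t - y t)\<^sup>2 \<le> 0"
    by (simp add: w_def mult_le_0_iff)
  then show ?thesis by simp
qed (use assms in simp)

text \<open>The fixed point is sought for \<open>e\<^sup>-\<^sup>2\<^sup>L\<^sup>t x(t)\<close>, for which the Picard operator is a
  contraction of bounded continuous functions on the whole half-line.\<close>

lemma ode_global_solution_exists:
  fixes F :: "real \<Rightarrow> real \<Rightarrow> real"
  assumes cont: "continuous_on UNIV (\<lambda>p. F (fst p) (snd p))"
    and lip: "\<And>t y z. \<bar>F t y - F t z\<bar> \<le> L * \<bar>y - z\<bar>" and "L > 0"
    and bound: "\<And>t y. \<bar>F t y\<bar> \<le> M"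
  shows "\<exists>x. x 0 = x0 \<and> (\<forall>t\<ge>0. (x has_real_derivative F t (x t)) (at t within {0..}))"
proof -
  \<comment> \<open>Twice the Lipschitz constant, which gives the contraction factor
    \<open>L / c = 1 / 2\<close>.\<close>
  define c where "c = 2 * L"
  have "c > 0" using \<open>L > 0\<close> by (simp add: c_def)
  have contF: "continuous_on A (\<lambda>s. F s (g s))" if "continuous_on A g" for A g
    using continuous_on_compose2[OF cont, of A "\<lambda>s. (s, g s)"] that
    by (simp add: continuous_intros)
  have M0: "M \<ge> 0" using bound[of 0 0] by linarith
  define I where "I y t = integral {0..t} (\<lambda>s. F s (exp (c * s) * y s))" for y t
  have int: "(\<lambda>s. F s (exp (c * s) * y s)) integrable_on {a..b}" if "continuous_on UNIV y" for y a b
    using that by (intro integrable_continuous_real contF continuous_intros) (auto intro: continuous_on_subset)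
  have dI: "(I y has_real_derivative F t (exp (c * t) * y t)) (at t within {0..})"
    if "continuous_on UNIV y" "0 \<le> t" for y t
  proof -
    have "(I y has_real_derivative F t (exp (c * t) * y t)) (at t within {0..t + 1})"
      unfolding I_def using that
      by (intro integral_has_real_derivative contF continuous_intros) (auto intro: continuous_on_subset)
    moreover have "at t within {0..t + 1} = at t within {0..}"
    proof (rule at_within_nhd[of t "{t - 1<..<t + 1}"])
      show "{0..t + 1} \<inter> {t - 1<..<t + 1} - {t} = {0..} \<inter> {t - 1<..<t + 1} - {t}" by auto
    qed auto
    ultimately show ?thesis by simp
  qed
  \<comment> \<open>\<open>max 0 t\<close> extends the operator to negative times by its value at
    \<open>0\<close>, since the function space lives on the whole line.\<close>
  define T where "T y t = exp (- (c * max 0 t)) * (x0 + I y (max 0 t))" for y t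
  have contT: "continuous_on UNIV (T y)" if "continuous_on UNIV y" for y
  proof -
    have "continuous_on {0..} (I y)"
      using dI[OF that] by (intro DERIV_continuous_on) auto
    then have "continuous_on UNIV (\<lambda>t. I y (max 0 t))"
      by (rule continuous_on_compose2) (auto intro!: continuous_intros)
    then show ?thesis unfolding T_def by (intro continuous_intros)
  qed
  \<comment> \<open>The integral of a bounded field grows at most linearly, so the exponential
    weight keeps \<open>T y\<close> bounded.\<close>
  have exp_le: "exp (- (c * t)) * t \<le> 1 / c" if "0 \<le> t" for t
  proof -
    have "c * t \<le> exp (c * t)" using exp_ge_add_one_self[of "c * t"] by linarith
    then show ?thesis using \<open>c > 0\<close> by (simp add: exp_minus field_simps)
  qed
  have boundT: "norm (T y t) \<le> \<bar>x0\<bar> + M / c" if "continuous_on UNIV y" for y t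
  proof -
    define r where "r = max 0 t"
    have r: "0 \<le> r" by (simp add: r_def)
    have "\<bar>I y r\<bar> \<le> M * r"
      using integral_bound[OF r, of "\<lambda>s. F s (exp (c * s) * y s)" M] bound that
        contF[of "{0..r}" "\<lambda>s. exp (c * s) * y s"]
      by (force simp: I_def intro!: continuous_intros elim: continuous_on_subset)
    then have "\<bar>x0 + I y r\<bar> \<le> \<bar>x0\<bar> + M * r" by linarith
    then have "\<bar>T y t\<bar> \<le> exp (- (c * r)) * (\<bar>x0\<bar> + M * r)"
      unfolding T_def r_def[symmetric] abs_mult by (intro mult_mono) auto
    also have "\<dots> = exp (- (c * r)) * \<bar>x0\<bar> + M * (exp (- (c * r)) * r)"
      by (simp add: algebra_simps)
    also have "\<dots> \<le> 1 * \<bar>x0\<bar> + M * (1 / c)"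
      using exp_le[OF r] r \<open>c > 0\<close> M0 by (intro add_mono mult_right_mono mult_left_mono) auto
    finally show ?thesis by simp
  qed
  define P where "P y = Bcontfun (T (apply_bcontfun y))" for y :: "real \<Rightarrow>\<^sub>C real"
  have P: "apply_bcontfun (P y) = T (apply_bcontfun y)" for y
    unfolding P_def using contT boundT
    by (intro Bcontfun_inverse bcontfun_normI[of _ "\<bar>x0\<bar> + M / c"]) auto
  have contr: "dist (P y) (P z) \<le> 1 / 2 * dist y z" for y z
  proof (rule dist_bound)
    fix t :: real
    define r where "r = max 0 t"
    define d where "d = dist y z"
    have r: "0 \<le> r" unfolding r_def by (rule max.cobounded1)
    have iE: "((\<lambda>s. L * (exp (c * s) * d)) has_integral (L * d / c * exp (c * r) - L * d / c * exp (c * 0))) {0..r}"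
    proof (rule fundamental_theorem_of_calculus[OF r])
      fix s assume "s \<in> {0..r}"
      show "((\<lambda>s. L * d / c * exp (c * s)) has_vector_derivative L * (exp (c * s) * d)) (at s within {0..r})"
        unfolding has_real_derivative_iff_has_vector_derivative[symmetric]
        using \<open>c > 0\<close> by (auto intro!: derivative_eq_intros)
    qed
    have "I y r - I z r = integral {0..r} (\<lambda>s. F s (exp (c * s) * y s) - F s (exp (c * s) * z s))"
      unfolding I_def by (intro integral_diff[symmetric] int) (auto intro: continuous_intros)
    also have "norm \<dots> \<le> integral {0..r} (\<lambda>s. L * (exp (c * s) * d))"
    proof (rule integral_norm_bound_integral)
      show "(\<lambda>s. F s (exp (c * s) * y s) - F s (exp (c * s) * z s)) integrable_on {0..r}"
        by (intro integrable_diff int) (auto intro: continuous_intros)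
      show "(\<lambda>s. L * (exp (c * s) * d)) integrable_on {0..r}" using iE by blast
      fix s assume "s \<in> {0..r}"
      have "\<bar>F s (exp (c * s) * y s) - F s (exp (c * s) * z s)\<bar> \<le> L * \<bar>exp (c * s) * y s - exp (c * s) * z s\<bar>"
        by (rule lip)
      also have "\<dots> = L * (exp (c * s) * \<bar>y s - z s\<bar>)"
        by (simp add: abs_mult flip: right_diff_distrib)
      also have "\<dots> \<le> L * (exp (c * s) * d)"
        using \<open>L > 0\<close> dist_bounded[of y s z] by (intro mult_left_mono) (auto simp: d_def dist_real_def)
      finally show "norm (F s (exp (c * s) * y s) - F s (exp (c * s) * z s)) \<le> L * (exp (c * s) * d)" by simp
    qed
    also have "\<dots> = L * d / c * (exp (c * r) - 1)"
      using integral_unique[OF iE] by (simp add: algebra_simps)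
    also have "\<dots> \<le> L * d / c * exp (c * r)"
      using \<open>L > 0\<close> \<open>c > 0\<close> by (intro mult_left_mono) (auto simp: d_def)
    finally have "\<bar>I y r - I z r\<bar> \<le> d / 2 * exp (c * r)"
      using \<open>L > 0\<close> by (simp add: c_def)
    then have "exp (- (c * r)) * \<bar>I y r - I z r\<bar> \<le> exp (- (c * r)) * (d / 2 * exp (c * r))"
      by (intro mult_left_mono) auto
    also have "\<dots> = d / 2" by (simp add: exp_minus)
    finally have "exp (- (c * r)) * \<bar>I y r - I z r\<bar> \<le> d / 2" .
    moreover have "T y t - T z t = exp (- (c * r)) * (I y r - I z r)"
      by (simp add: T_def r_def algebra_simps)
    ultimately show "dist (P y t) (P z t) \<le> 1 / 2 * dist y z"
      unfolding P by (simp add: dist_real_def abs_mult d_def)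
  qed
  have "\<exists>!y. P y = y"
    by (rule banach_fix_type[of "1/2"]) (use contr in auto)
  then obtain y where "P y = y" by blast
  then have y: "y t = T y t" for t by (metis P)
  have cy: "continuous_on UNIV (apply_bcontfun y)" by (auto intro: continuous_intros)
  define x where "x t = x0 + I y t" for t
  have xy: "x t = exp (c * t) * y t" if "0 \<le> t" for t
    using that y[of t] by (simp add: T_def x_def max_def exp_minus)
  have "(x has_real_derivative F t (x t)) (at t within {0..})" if "0 \<le> t" for t
    using dI[OF cy that] xy[OF that] unfolding x_def by (auto intro!: derivative_eq_intros)
  moreover have "x 0 = x0" by (simp add: x_def I_def)
  ultimately show ?thesis by blast
qed

section \<open>Practical stability\<close>

text \<open>\<open>\<mu> * \<beta>2 \<le> 1\<close> rules out overshooting: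
  \<open>e - \<mu> * j\<close> does not change sign, and the lower bound on \<open>j * e\<close>
  shortens it by at least \<open>\<mu> * \<beta>1 * \<bar>e\<bar>\<close>.\<close>

lemma euler_step_contraction:
  fixes e j \<mu> \<beta>1 \<beta>2 :: real
  assumes "j * e \<ge> \<beta>1 * \<bar>e\<bar>\<^sup>2" "\<bar>j\<bar> \<le> \<beta>2 * \<bar>e\<bar>" "0 < \<mu>" "\<mu> * \<beta>2 \<le> 1"
  shows "\<bar>e - \<mu> * j\<bar> \<le> (1 - \<mu> * \<beta>1) * \<bar>e\<bar>"
proof -
  have pos: "\<bar>e - \<mu> * j\<bar> \<le> (1 - \<mu> * \<beta>1) * e"
    if "0 < e" "j * e \<ge> \<beta>1 * e\<^sup>2" "\<bar>j\<bar> \<le> \<beta>2 * e" for e j :: real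
  proof -
    have "\<beta>1 * e * e \<le> j * e" using that by (simp add: power2_eq_square)
    then have "\<beta>1 * e \<le> j" using \<open>0 < e\<close> by simp
    then have 1: "\<mu> * (\<beta>1 * e) \<le> \<mu> * j" using \<open>0 < \<mu>\<close> by simp
    have "\<mu> * j \<le> \<mu> * (\<beta>2 * e)" using that(3) \<open>0 < \<mu>\<close> by simp
    also have "\<dots> \<le> 1 * e" unfolding mult.assoc[symmetric] using assms(4) that(1) by (intro mult_right_mono) auto
    finally show ?thesis using 1 by (simp add: algebra_simps)
  qed
  consider "e = 0" | "0 < e" | "e < 0" by linarith
  then show ?thesis
  proof cases
    case 1
    then show ?thesis using assms(2) by simp
  next
    case 2
    then show ?thesis using pos[of e j] assms by simp
  next
    case 3
    then have "\<bar>- e - \<mu> * (- j)\<bar> \<le> (1 - \<mu> * \<beta>1) * (- e)"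
      using assms by (intro pos) auto
    moreover have "- e - \<mu> * (- j) = - (e - \<mu> * j)" by simp
    ultimately show ?thesis using 3 by (simp only: abs_minus_cancel abs_of_neg)
  qed
qed

text \<open>\<open>r\<close> is the fixed point of the affine recursion, and the excess over it
  shrinks by \<open>1 - q \<le> exp (- q)\<close> per step.\<close>

lemma geometric_decay:
  fixes e :: "nat \<Rightarrow> real"
  assumes "0 \<le> q" "q \<le> 1" "0 \<le> e 0" "0 \<le> r" "\<And>k. e (Suc k) \<le> (1 - q) * e k + q * r"
  shows "e k \<le> exp (- (q * real k)) * e 0 + r"
proof (induction k)
  case 0
  then show ?case using assms by simp
next
  case (Suc k)
  have "e (Suc k) \<le> (1 - q) * (exp (- (q * real k)) * e 0 + r) + q * r"
    using assms(5)[of k] Suc.IH assms(2) mult_left_mono[OF Suc.IH, of "1 - q"] by linarith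
  also have "\<dots> = (1 - q) * (exp (- (q * real k)) * e 0) + r" by (simp add: algebra_simps)
  also have "\<dots> \<le> exp (- q) * (exp (- (q * real k)) * e 0) + r"
    using assms exp_ge_add_one_self[of "- q"] by (intro add_mono mult_right_mono) auto
  also have "\<dots> = exp (- (q * real (Suc k))) * e 0 + r"
    by (simp add: algebra_simps flip: mult.assoc exp_add)
  finally show ?case .
qed

text \<open>Clamping the state to a compact interval makes the field bounded and Lipschitz, hence
  globally solvable. Over each period the distance to \<open>xs\<close> contracts up to a small
  error, so it stays at most \<open>\<delta>\<close> at integer times; the drift in between is too
  small to leave the interval. Thus the clamping never acts on the solution.\<close>

lemma scaled_practical_stability:
  fixes f :: "bool \<Rightarrow> real \<Rightarrow> real" and N \<kappa> :: nat and c1 c2 \<sigma> \<beta>1 \<beta>2 \<delta> \<delta>' \<rho> xs :: real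
  defines "v \<equiv> (\<lambda>i s. if i then c1 * cos (2 * pi * real \<kappa> * s) else c2 * sin (real N * (2 * pi * real \<kappa>) * s))"
  assumes "odd N" "\<kappa> \<ge> 1"
    and c12: "c1 ^ N * c2 = (4 * pi * real \<kappa>) ^ N * fact N * (-1) ^ (N div 2)"
    and "open D" and fC: "\<And>i. C_on (Suc N) (f i) D"
    and ad: "\<And>x. x \<in> D \<Longrightarrow> ad_pow (f True) N (f False) x = - \<sigma> * j x"
    and j1: "\<And>x. x \<in> D \<Longrightarrow> j x * (x - xs) \<ge> \<beta>1 * \<bar>x - xs\<bar>\<^sup>2"
    and j2: "\<And>x. x \<in> D \<Longrightarrow> \<bar>j x\<bar> \<le> \<beta>2 * \<bar>x - xs\<bar>"
    and pos: "\<sigma> > 0" "\<beta>1 > 0" "0 < \<delta>" "\<delta> < \<delta>'" "0 < \<rho>"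
    and sub: "{xs - \<delta>'..xs + \<delta>'} \<subseteq> D"
  shows "\<exists>\<eta>1>0. \<forall>\<eta> x0. 0 < \<eta> \<and> \<eta> \<le> \<eta>1 \<and> \<bar>x0 - xs\<bar> < \<delta> \<longrightarrow>
    (\<exists>X. X 0 = x0 \<and> (\<forall>t\<ge>0. X t \<in> {xs - \<delta>'..xs + \<delta>'} \<and>
      (X has_real_derivative \<eta> * (\<Sum>i\<in>UNIV. f i (X t) * v i t)) (at t within {0..}) \<and>
      \<bar>X t - xs\<bar> \<le> exp (\<sigma> * \<beta>1 * \<eta> ^ Suc N) * exp (- (\<sigma> * \<beta>1 * \<eta> ^ Suc N * t)) * \<bar>x0 - xs\<bar> + \<rho>))"
proof -
  define a where "a = xs - \<delta>'"
  define b where "b = xs + \<delta>'"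
  define cl where "cl y = max a (min b y)" for y
  have ab: "a \<le> b" "{a..b} \<subseteq> D" using pos sub by (auto simp: a_def b_def)
  have cl: "cl y \<in> {a..b}" "\<bar>cl y - cl z\<bar> \<le> \<bar>y - z\<bar>" for y z
    using ab by (auto simp: cl_def max_def min_def abs_if)
  have cl_id: "cl y = y" if "y \<in> {a..b}" for y
    using that by (simp add: cl_def)
  define Vb where "Vb = \<bar>c1\<bar> + \<bar>c2\<bar>"
  have vb: "\<bar>v i s\<bar> \<le> Vb" for i s
    unfolding v_def Vb_def by (rule sinusoid_bound)
  have Vb0: "0 \<le> Vb" by (simp add: Vb_def)
  have v_per: "v i (real k + s) = v i s" for i k s
  proof -
    have "cos (2 * pi * real \<kappa> * (real k + s)) = cos (2 * pi * real \<kappa> * s)"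
    proof -
      have "2 * pi * real \<kappa> * (real k + s) = 2 * pi * real \<kappa> * s + 2 * pi * of_int (int (\<kappa> * k))"
        by (simp add: algebra_simps)
      then show ?thesis by (simp only: cos_add sin_int_2pin cos_int_2pin mult_1_right mult_zero_right diff_zero)
    qed
    moreover have "sin (real N * (2 * pi * real \<kappa>) * (real k + s)) = sin (real N * (2 * pi * real \<kappa>) * s)"
    proof -
      have "real N * (2 * pi * real \<kappa>) * (real k + s) =
          real N * (2 * pi * real \<kappa>) * s + 2 * pi * of_int (int (N * \<kappa> * k))"
        by (simp add: algebra_simps)
      then show ?thesis by (simp only: sin_add sin_int_2pin cos_int_2pin mult_1_right mult_zero_right add_0_right)
    qed
    ultimately show ?thesis by (simp add: v_def)
  qed
  have fC1: "C_on 1 (f i) D" for i using fC by (rule C_on_mono) auto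
  obtain B1 B2 where "B1 \<ge> 0" "B2 \<ge> 0"
    and B12: "\<And>x. x \<in> {a..b} \<Longrightarrow> \<bar>f True x\<bar> \<le> B1" "\<And>x. x \<in> {a..b} \<Longrightarrow> \<bar>f False x\<bar> \<le> B2"
    using C_on_bounded[OF fC1 ab(2)] by metis
  have fB: "\<bar>f i x\<bar> \<le> B1 + B2" if "x \<in> {a..b}" for i x
    using B12[OF that] \<open>B1 \<ge> 0\<close> \<open>B2 \<ge> 0\<close> by (cases "i = True") auto
  have B0: "0 \<le> B1 + B2" using \<open>B1 \<ge> 0\<close> \<open>B2 \<ge> 0\<close> by simp
  obtain L1 L2 where "L1 \<ge> 0" "L2 \<ge> 0"
    and L12: "\<And>x y. x \<in> {a..b} \<Longrightarrow> y \<in> {a..b} \<Longrightarrow> \<bar>f True x - f True y\<bar> \<le> L1 * \<bar>x - y\<bar>"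
    "\<And>x y. x \<in> {a..b} \<Longrightarrow> y \<in> {a..b} \<Longrightarrow> \<bar>f False x - f False y\<bar> \<le> L2 * \<bar>x - y\<bar>"
    using C_on_1_lipschitz[OF fC1 ab(2)] by metis
  define G where "G t y = (\<Sum>i\<in>UNIV. f i (cl y) * v i t)" for t y
  define M where "M = (B1 + B2) * Vb + (B1 + B2) * Vb"
  have GM: "\<bar>G t y\<bar> \<le> M" for t y
  proof -
    have "\<bar>f i (cl y) * v i t\<bar> \<le> (B1 + B2) * Vb" for i
      unfolding abs_mult using fB[OF cl(1)] B0 vb by (intro mult_mono) auto
    moreover have "G t y = f True (cl y) * v True t + f False (cl y) * v False t"
      by (simp add: G_def UNIV_bool)
    ultimately show ?thesis
      unfolding M_def by (simp only:) (rule order_trans[OF abs_triangle_ineq add_mono])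
  qed
  have M0: "0 \<le> M" using GM[of 0 0] by linarith
  \<comment> \<open>The summand \<open>1\<close> keeps \<open>L\<close> positive even if the other
    terms vanish.\<close>
  define L where "L = L1 * Vb + L2 * Vb + 1"
  have L0: "0 < L" using \<open>L1 \<ge> 0\<close> \<open>L2 \<ge> 0\<close> Vb0 by (simp add: L_def add_nonneg_pos)
  have GL: "\<bar>G t y - G t z\<bar> \<le> L * \<bar>y - z\<bar>" for t y z
  proof -
    have 1: "\<bar>(f i (cl y) - f i (cl z)) * v i t\<bar> \<le> l * Vb * \<bar>y - z\<bar>"
      if "\<And>x y. x \<in> {a..b} \<Longrightarrow> y \<in> {a..b} \<Longrightarrow> \<bar>f i x - f i y\<bar> \<le> l * \<bar>x - y\<bar>" "0 \<le> l" for i l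
    proof -
      have "\<bar>f i (cl y) - f i (cl z)\<bar> \<le> l * \<bar>y - z\<bar>"
        using that(1)[OF cl(1) cl(1), of y z] mult_left_mono[OF cl(2)[of y z] \<open>0 \<le> l\<close>] by linarith
      then have "\<bar>(f i (cl y) - f i (cl z)) * v i t\<bar> \<le> (l * \<bar>y - z\<bar>) * Vb"
        unfolding abs_mult using vb that(2) by (intro mult_mono) auto
      then show ?thesis by (simp add: mult_ac)
    qed
    have "G t y - G t z = (f True (cl y) - f True (cl z)) * v True t + (f False (cl y) - f False (cl z)) * v False t"
      by (simp add: G_def UNIV_bool algebra_simps)
    moreover have "\<bar>(f True (cl y) - f True (cl z)) * v True t\<bar> \<le> L1 * Vb * \<bar>y - z\<bar>"
      using L12(1) \<open>L1 \<ge> 0\<close> by (rule 1)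
    moreover have "\<bar>(f False (cl y) - f False (cl z)) * v False t\<bar> \<le> L2 * Vb * \<bar>y - z\<bar>"
      using L12(2) \<open>L2 \<ge> 0\<close> by (rule 1)
    ultimately have "\<bar>G t y - G t z\<bar> \<le> L1 * Vb * \<bar>y - z\<bar> + L2 * Vb * \<bar>y - z\<bar>"
      by (simp only:)
    also have "\<dots> \<le> L * \<bar>y - z\<bar>" by (simp add: L_def algebra_simps)
    finally show ?thesis .
  qed
  have Gcont: "continuous_on UNIV (\<lambda>p. G (fst p) (snd p))"
  proof -
    have "continuous_on UNIV (\<lambda>p :: real \<times> real. f i (cl (snd p)))" for i
    proof (rule continuous_on_compose2[of "{a..b}" "f i" UNIV "\<lambda>p. cl (snd p)"])
      show "continuous_on {a..b} (f i)"
        using C_on_imp_continuous_on[OF fC1] ab(2) continuous_on_subset by blast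
      show "continuous_on UNIV (\<lambda>p :: real \<times> real. cl (snd p))"
        unfolding cl_def by (intro continuous_intros)
    qed (use cl in auto)
    moreover have "continuous_on UNIV (\<lambda>p :: real \<times> real. v i (fst p))" for i
      unfolding v_def by (cases i) (auto intro!: continuous_intros)
    ultimately show ?thesis unfolding G_def by (intro continuous_intros) auto
  qed
  define avg_bound where "avg_bound C \<eta>0 \<longleftrightarrow> (\<forall>\<eta> X. 0 < \<eta> \<and> \<eta> \<le> \<eta>0 \<and>
    (\<forall>s\<in>{0..1}. X s \<in> {a..b} \<and>
      (X has_real_derivative \<eta> * (\<Sum>i\<in>UNIV. f i (X s) * v i s)) (at s within {0..1})) \<longrightarrow>
    \<bar>X 1 - X 0 - \<eta> ^ Suc N * ad_pow (f True) N (f False) (X 0)\<bar> \<le> C * \<eta> ^ Suc N * \<eta>)" for C \<eta>0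
  have "\<exists>C\<ge>0. \<exists>\<eta>0>0. avg_bound C \<eta>0"
    unfolding avg_bound_def v_def
    by (rule averaging_estimate[where f=f, OF \<open>odd N\<close> \<open>\<kappa> \<ge> 1\<close> c12 \<open>open D\<close> fC ab(2)])
  then obtain C \<eta>0 where "C \<ge> 0" "\<eta>0 > 0" and avg: "avg_bound C \<eta>0" by blast
  \<comment> \<open>Both bounds on \<open>j\<close> are compared at the point
    \<open>xs + \<delta>\<close>. The inequality later yields \<open>q \<le> 1\<close>.\<close>
  have "\<beta>1 \<le> \<beta>2"
  proof -
    have "xs + \<delta> \<in> D" using sub pos by auto
    from j1[OF this] j2[OF this] have "\<beta>1 * \<delta> * \<delta> \<le> j (xs + \<delta>) * \<delta>" "j (xs + \<delta>) \<le> \<beta>2 * \<delta>"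
      using pos by (auto simp: power2_eq_square)
    then have "\<beta>1 * \<delta> \<le> \<beta>2 * \<delta>" using pos by (metis mult_le_cancel_right_pos order_trans)
    then show ?thesis using pos by simp
  qed
  \<comment> \<open>Chosen so that the averaging error \<open>C * E * \<eta>\<close> equals
    \<open>q * (\<eta> * r)\<close>: then \<open>\<eta> * r\<close> is the residual radius of the
    contraction.\<close>
  define r where "r = C / (\<sigma> * \<beta>1)"
  have r0: "0 \<le> r" using \<open>C \<ge> 0\<close> pos by (simp add: r_def)
  \<comment> \<open>The sum of all thresholds, so that \<open>\<eta> \<le> 1 / S\<close> implies
    every smallness condition at once.\<close>
  define S where "S = 1 + 1 / \<eta>0 + M / (\<delta>' - \<delta>) + r / \<delta> + \<sigma> * \<beta>2 + (r + M) / \<rho>"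
  have S_terms: "0 \<le> 1 / \<eta>0" "0 \<le> M / (\<delta>' - \<delta>)" "0 \<le> r / \<delta>" "0 \<le> \<sigma> * \<beta>2" "0 \<le> (r + M) / \<rho>"
    using \<open>\<eta>0 > 0\<close> M0 r0 pos \<open>\<beta>1 \<le> \<beta>2\<close> by auto
  then have "S \<ge> 1" by (simp add: S_def)
  have main: "\<exists>X. X 0 = x0 \<and> (\<forall>t\<ge>0. X t \<in> {a..b} \<and>
      (X has_real_derivative \<eta> * (\<Sum>i\<in>UNIV. f i (X t) * v i t)) (at t within {0..}) \<and>
      \<bar>X t - xs\<bar> \<le> exp (\<sigma> * \<beta>1 * \<eta> ^ Suc N) * exp (- (\<sigma> * \<beta>1 * \<eta> ^ Suc N * t)) * \<bar>x0 - xs\<bar> + \<rho>)"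
    if "0 < \<eta>" "\<eta> \<le> 1 / S" "\<bar>x0 - xs\<bar> < \<delta>" for \<eta> x0
  proof -
    have "\<eta> * S \<le> 1" using that(2) \<open>S \<ge> 1\<close> by (simp add: field_simps)
    then have le1: "\<eta> * u \<le> 1" if "u \<le> S" for u
      using mult_left_mono[OF that, of \<eta>] \<open>0 < \<eta>\<close> by linarith
    have \<eta>: "\<eta> \<le> 1" "\<eta> \<le> \<eta>0" "\<eta> * M \<le> \<delta>' - \<delta>" "\<eta> * r \<le> \<delta>" "\<eta> * (\<sigma> * \<beta>2) \<le> 1" "\<eta> * r + \<eta> * M \<le> \<rho>"
    proof -
      have le2: "\<eta> * u \<le> d" if "0 < d" "u / d \<le> S" for u d
        using le1[OF that(2)] that(1) by (simp add: pos_divide_le_eq)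
      show "\<eta> \<le> 1" using le1[of 1] S_terms unfolding S_def by simp
      show "\<eta> \<le> \<eta>0" using le2[of \<eta>0 1] S_terms \<open>\<eta>0 > 0\<close> unfolding S_def by simp
      show "\<eta> * M \<le> \<delta>' - \<delta>" using S_terms pos by (intro le2) (simp_all add: S_def)
      show "\<eta> * r \<le> \<delta>" using S_terms pos by (intro le2) (simp_all add: S_def)
      show "\<eta> * (\<sigma> * \<beta>2) \<le> 1" using S_terms by (intro le1) (simp add: S_def)
      have "\<eta> * (r + M) \<le> \<rho>" using S_terms pos by (intro le2) (simp_all add: S_def)
      then show "\<eta> * r + \<eta> * M \<le> \<rho>" by (simp add: distrib_left)
    qed
    define E where "E = \<eta> ^ Suc N"
    have "\<eta> * \<eta> ^ N \<le> \<eta> * 1"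
      using \<open>0 < \<eta>\<close> \<eta>(1) by (intro mult_left_mono power_le_one) auto
    then have E: "0 < E" "E \<le> \<eta>" using \<open>0 < \<eta>\<close> by (auto simp: E_def)
    define q where "q = \<sigma> * \<beta>1 * E"
    have "E * (\<sigma> * \<beta>2) \<le> 1"
      using mult_right_mono[OF E(2) S_terms(4)] \<eta>(5) by linarith
    moreover have "q \<le> E * (\<sigma> * \<beta>2)"
      using \<open>\<beta>1 \<le> \<beta>2\<close> pos E by (simp add: q_def mult_ac)
    moreover have "0 \<le> q" using pos E by (simp add: q_def)
    ultimately have q: "0 \<le> q" "q \<le> 1" by linarith+
    obtain X where X0: "X 0 = x0"
      and dX: "\<And>t. 0 \<le> t \<Longrightarrow> (X has_real_derivative \<eta> * G t (X t)) (at t within {0..})"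
    proof -
      have "\<exists>x. x 0 = x0 \<and> (\<forall>t\<ge>0. (x has_real_derivative \<eta> * G t (x t)) (at t within {0..}))"
      proof (rule ode_global_solution_exists[OF _ _ L0])
        show "continuous_on UNIV (\<lambda>p. \<eta> * G (fst p) (snd p))"
          using Gcont by (intro continuous_intros)
        show "\<bar>\<eta> * G t y - \<eta> * G t z\<bar> \<le> L * \<bar>y - z\<bar>" for t y z
        proof -
          have "\<bar>\<eta> * G t y - \<eta> * G t z\<bar> = \<eta> * \<bar>G t y - G t z\<bar>"
            using \<open>0 < \<eta>\<close> by (simp add: abs_mult flip: right_diff_distrib)
          also have "\<dots> \<le> 1 * (L * \<bar>y - z\<bar>)"
            using GL \<eta>(1) by (intro mult_mono) auto
          finally show ?thesis by simp
        qed
        show "\<bar>\<eta> * G t y\<bar> \<le> M" for t y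
        proof -
          have "\<bar>\<eta> * G t y\<bar> \<le> 1 * M"
            unfolding abs_mult using GM \<eta>(1) \<open>0 < \<eta>\<close> by (intro mult_mono) auto
          then show ?thesis by simp
        qed
      qed
      with that show ?thesis by blast
    qed
    \<comment> \<open>The \<open>k\<close>-th period moved to the unit interval. As the dither has
      period one, the averaging estimate applies to each of them.\<close>
    define Y where "Y k s = X (real k + s)" for k s
    have dY: "(Y k has_real_derivative \<eta> * G s (Y k s)) (at s within {0..1})" if "s \<in> {0..1}" for k s
    proof -
      have "(X has_real_derivative \<eta> * G (real k + s) (X (real k + s))) (at (real k + s) within (+) (real k) ` {0..1})"
        using that by (intro has_field_derivative_subset[OF dX]) auto
      moreover have "G (real k + s) y = G s y" for y by (simp add: G_def v_per)
      ultimately show ?thesis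
        unfolding Y_def by (simp only: DERIV_at_within_shift)
    qed
    have Ys: "\<bar>Y k s - X k\<bar> \<le> \<eta> * M" if "s \<in> {0..1}" for k s
    proof -
      have "\<bar>Y k s - Y k 0\<bar> \<le> \<eta> * M"
      proof (rule real_derivative_bound[OF dY _ that])
        show "\<bar>\<eta> * G s (Y k s)\<bar> \<le> \<eta> * M" for s
          unfolding abs_mult using GM \<open>0 < \<eta>\<close> by (intro mult_mono) auto
      qed
      then show ?thesis by (simp add: Y_def)
    qed
    have Yab: "Y k s \<in> {a..b}" if "\<bar>X k - xs\<bar> \<le> \<delta>" "s \<in> {0..1}" for k s
      using Ys[OF that(2), of k] that(1) \<eta>(3) unfolding a_def b_def atLeastAtMost_iff by linarith
    have step: "\<bar>X (real (Suc k)) - xs\<bar> \<le> (1 - q) * \<bar>X k - xs\<bar> + q * (\<eta> * r)"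
      if "\<bar>X k - xs\<bar> \<le> \<delta>" for k
    proof -
      have Y0: "Y k 0 = X k" "Y k 1 = X (real (Suc k))" by (simp_all add: Y_def add.commute)
      have XD: "X k \<in> D" using Yab[OF that, of 0] ab by (auto simp: Y0)
      have "\<forall>s\<in>{0..1}. Y k s \<in> {a..b} \<and>
          (Y k has_real_derivative \<eta> * (\<Sum>i\<in>UNIV. f i (Y k s) * v i s)) (at s within {0..1})"
        using dY[of _ k] Yab[OF that] cl_id by (simp add: G_def)
      then have "\<bar>Y k 1 - Y k 0 - E * ad_pow (f True) N (f False) (Y k 0)\<bar> \<le> C * E * \<eta>"
        using avg[unfolded avg_bound_def, rule_format, of \<eta> "Y k"] \<open>0 < \<eta>\<close> \<eta>(2)
        unfolding E_def by blast
      then have "\<bar>X (real (Suc k)) - X k - E * (- \<sigma> * j (X k))\<bar> \<le> C * E * \<eta>"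
        unfolding Y0 ad[OF XD] .
      moreover have "\<bar>X k - xs - (E * \<sigma>) * j (X k)\<bar> \<le> (1 - q) * \<bar>X k - xs\<bar>"
      proof -
        have "q = E * \<sigma> * \<beta>1" by (simp add: q_def)
        then show ?thesis
          using euler_step_contraction[OF j1[OF XD] j2[OF XD], of "E * \<sigma>"] \<open>E * (\<sigma> * \<beta>2) \<le> 1\<close> E pos
          by (simp add: mult.assoc)
      qed
      moreover have "C * E * \<eta> = q * (\<eta> * r)" using pos by (simp add: q_def r_def)
      moreover have "E * (- \<sigma> * j (X k)) = - ((E * \<sigma>) * j (X k))" by simp
      ultimately show ?thesis by linarith
    qed
    have inv: "\<bar>X (real k) - xs\<bar> \<le> \<delta>" for k
    proof (induction k)
      case 0
      then show ?case using that X0 by simp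
    next
      case (Suc k)
      have "(1 - q) * \<bar>X k - xs\<bar> + q * (\<eta> * r) \<le> (1 - q) * \<delta> + q * \<delta>"
        using Suc q \<eta>(4) by (intro add_mono mult_left_mono) auto
      with step[OF Suc] show ?case by (simp add: algebra_simps)
    qed
    have decay: "\<bar>X (real k) - xs\<bar> \<le> exp (- (q * real k)) * \<bar>x0 - xs\<bar> + \<eta> * r" for k
      using geometric_decay[of q "\<lambda>k. \<bar>X (real k) - xs\<bar>" "\<eta> * r" k] q step[OF inv] r0 \<open>0 < \<eta>\<close> X0
      by simp
    have "X t \<in> {a..b} \<and>
      (X has_real_derivative \<eta> * (\<Sum>i\<in>UNIV. f i (X t) * v i t)) (at t within {0..}) \<and>
      \<bar>X t - xs\<bar> \<le> exp q * exp (- (q * t)) * \<bar>x0 - xs\<bar> + \<rho>" if "0 \<le> t" for t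
    proof -
      define k where "k = nat \<lfloor>t\<rfloor>"
      define s where "s = t - real k"
      have s: "s \<in> {0..1}" using that by (simp add: s_def k_def) linarith
      have t: "X t = Y k s" by (simp add: Y_def s_def)
      have "X t \<in> {a..b}" unfolding t by (rule Yab[OF inv s])
      moreover have "(X has_real_derivative \<eta> * (\<Sum>i\<in>UNIV. f i (X t) * v i t)) (at t within {0..})"
        using dX[OF that] cl_id[OF \<open>X t \<in> {a..b}\<close>] by (simp add: G_def)
      moreover have "\<bar>X t - xs\<bar> \<le> exp q * exp (- (q * t)) * \<bar>x0 - xs\<bar> + \<rho>"
      proof -
        \<comment> \<open>At most one period separates \<open>t\<close> from the last integer time,
          which costs the factor \<open>exp q\<close>.\<close>
        have "q * t \<le> q + q * real k"
          using s q mult_left_mono[of t "1 + real k" q] by (simp add: s_def algebra_simps)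
        then have "exp (- (q * real k)) \<le> exp q * exp (- (q * t))"
          by (simp flip: exp_add)
        then have "exp (- (q * real k)) * \<bar>x0 - xs\<bar> \<le> exp q * exp (- (q * t)) * \<bar>x0 - xs\<bar>"
          by (intro mult_right_mono) auto
        with decay[of k] Ys[OF s, of k] \<eta>(6) show ?thesis unfolding t by linarith
      qed
      ultimately show ?thesis by blast
    qed
    with X0 show ?thesis unfolding q_def E_def by blast
  qed
  show ?thesis
    using main \<open>S \<ge> 1\<close> unfolding a_def b_def by (intro exI[of _ "1 / S"]) auto
qed

section \<open>Return to the original time scale, and uniqueness\<close>

theorem theorem2:
  fixes D :: "real set" and m N \<kappa> :: nat
    and J g1 g2 :: "real \<Rightarrow> real"
    and xs Js \<alpha>1 \<alpha>2 \<beta>1 \<beta>2 \<sigma> c1 c2 :: real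
  assumes "open D" and "connected D" and "D \<noteq> {}"
    and "m \<ge> 2"
    and "C_on m J D"
    and "xs \<in> D"
    and "\<forall>x\<in>D. deriv J x = 0 \<longleftrightarrow> x = xs"
    and "\<forall>x\<in>D - {xs}. J x > Js"
    and "\<alpha>1 > 0" and "\<alpha>2 > 0" and "\<beta>1 > 0" and "\<beta>2 > 0"
    and "\<forall>x\<in>D. \<alpha>1 * \<bar>x - xs\<bar> ^ m \<le> J x - Js \<and> J x - Js \<le> \<alpha>2 * \<bar>x - xs\<bar> ^ m"
    and "\<forall>x\<in>D. (deriv ^^ (m - 1)) J x * (x - xs) \<ge> \<beta>1 * \<bar>x - xs\<bar>\<^sup>2"
    and "\<forall>x\<in>D. \<bar>(deriv ^^ (m - 1)) J x\<bar> \<le> \<beta>2 * \<bar>x - xs\<bar>"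
    and "N = m - 1"
    and "C_on m (g1 \<circ> J) D" and "C_on m (g2 \<circ> J) D"
    and "\<sigma> > 0"
    and "\<forall>x\<in>D. ad_pow (g1 \<circ> J) N (g2 \<circ> J) x = - \<sigma> * (deriv ^^ N) J x"
    and "\<kappa> \<ge> 1"
    and "c1 ^ N * c2 = (4 * pi * real \<kappa>) ^ N * fact N * (-1) ^ (N div 2)"
  shows "\<forall>\<delta>>0. closure (ball xs \<delta>) \<subseteq> D \<longrightarrow>
    (\<forall>\<gamma>bar\<in>{0<..<\<sigma> * \<beta>1}. \<forall>\<rho>\<in>{0<..<\<delta>}.
      \<exists>\<epsilon>bar>0. \<forall>\<epsilon>\<in>{0<..\<epsilon>bar}. \<forall>\<gamma>\<in>{0<..\<gamma>bar}.
        \<exists>lam>0. \<forall>x0\<in>ball xs \<delta>.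
          \<exists>x. is_global_solution D
                (\<lambda>t y. g1 (J y) * dither1 N \<kappa> c1 \<epsilon> t + g2 (J y) * dither2 N \<kappa> c2 \<epsilon> t) x0 x \<and>
              (\<forall>t\<ge>0. \<bar>x t - xs\<bar> \<le> lam * \<bar>x0 - xs\<bar> * exp (- \<gamma> * t) + \<rho>))"
proof (intro allI impI ballI)
  fix \<delta> \<gamma>bar \<rho> :: real
  assume "\<delta> > 0" and ball: "closure (ball xs \<delta>) \<subseteq> D"
    and gbar: "\<gamma>bar \<in> {0<..<\<sigma> * \<beta>1}" and rho: "\<rho> \<in> {0<..<\<delta>}"
  define f where "f i = (if i then g1 \<circ> J else g2 \<circ> J)" for i
  define v where "v i s = (if i then c1 * cos (2 * pi * real \<kappa> * s)
    else c2 * sin (real N * (2 * pi * real \<kappa>) * s))" for i s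
  define F where "F \<epsilon> t y = g1 (J y) * dither1 N \<kappa> c1 \<epsilon> t + g2 (J y) * dither2 N \<kappa> c2 \<epsilon> t" for \<epsilon> t y
  have m: "m = Suc N" using \<open>m \<ge> 2\<close> \<open>N = m - 1\<close> by simp
  have "odd N"
    unfolding \<open>N = m - 1\<close>
    by (rule order_of_minimum_even[OF assms(1,6,4,5,8,13,10,11,12,14,15)])
  have fC: "C_on (Suc N) (f i) D" for i
    using \<open>C_on m (g1 \<circ> J) D\<close> \<open>C_on m (g2 \<circ> J) D\<close> by (simp add: f_def m)
  have "cball xs \<delta> \<subseteq> D" using ball \<open>\<delta> > 0\<close> by simp
  moreover have "xs - \<delta> \<in> cball xs \<delta>" "xs + \<delta> \<in> cball xs \<delta>" using \<open>\<delta> > 0\<close> by (simp_all add: dist_real_def)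
  ultimately have "xs - \<delta> \<in> D" "xs + \<delta> \<in> D" by blast+
  then obtain e1 e2 where e: "e1 > 0" "cball (xs - \<delta>) e1 \<subseteq> D" "e2 > 0" "cball (xs + \<delta>) e2 \<subseteq> D"
    using \<open>open D\<close> by (meson open_contains_cball)
  \<comment> \<open>Openness of \<open>D\<close> gives room beyond the closed ball; this margin
    accommodates the drift within one period.\<close>
  define \<delta>' where "\<delta>' = \<delta> + min e1 e2"
  have "\<delta> < \<delta>'" using e by (simp add: \<delta>'_def)
  have sub: "{xs - \<delta>'..xs + \<delta>'} \<subseteq> D"
  proof
    fix y assume y: "y \<in> {xs - \<delta>'..xs + \<delta>'}"
    then have "y \<in> {xs - \<delta> - e1..xs - \<delta>} \<or> y \<in> {xs - \<delta>..xs + \<delta>} \<or> y \<in> {xs + \<delta>..xs + \<delta> + e2}"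
      by (auto simp: \<delta>'_def)
    then show "y \<in> D"
    proof (elim disjE)
      assume "y \<in> {xs - \<delta> - e1..xs - \<delta>}"
      then have "y \<in> cball (xs - \<delta>) e1" by (simp add: dist_real_def)
      with e show ?thesis by blast
    next
      assume "y \<in> {xs - \<delta>..xs + \<delta>}"
      then have "y \<in> cball xs \<delta>" by (simp add: dist_real_def abs_le_iff)
      with \<open>cball xs \<delta> \<subseteq> D\<close> show ?thesis by blast
    next
      assume "y \<in> {xs + \<delta>..xs + \<delta> + e2}"
      then have "y \<in> cball (xs + \<delta>) e2" by (simp add: dist_real_def)
      with e show ?thesis by blast
    qed
  qed
  define decays where "decays \<eta> x0 \<longleftrightarrow> (\<exists>X. X 0 = x0 \<and> (\<forall>t\<ge>0. X t \<in> {xs - \<delta>'..xs + \<delta>'} \<and>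
      (X has_real_derivative \<eta> * (\<Sum>i\<in>UNIV. f i (X t) * v i t)) (at t within {0..}) \<and>
      \<bar>X t - xs\<bar> \<le> exp (\<sigma> * \<beta>1 * \<eta> ^ Suc N) * exp (- (\<sigma> * \<beta>1 * \<eta> ^ Suc N * t)) * \<bar>x0 - xs\<bar> + \<rho>))"
    for \<eta> x0
  have "\<exists>\<eta>1>0. \<forall>\<eta> x0. 0 < \<eta> \<and> \<eta> \<le> \<eta>1 \<and> \<bar>x0 - xs\<bar> < \<delta> \<longrightarrow> decays \<eta> x0"
    unfolding decays_def v_def
  proof (rule scaled_practical_stability[where f=f and j="(deriv ^^ N) J", OF \<open>odd N\<close> assms(21,22,1) fC _ _ _
        \<open>\<sigma> > 0\<close> \<open>\<beta>1 > 0\<close> \<open>\<delta> > 0\<close> \<open>\<delta> < \<delta>'\<close> _ sub])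
    fix x assume "x \<in> D"
    then show "ad_pow (f True) N (f False) x = - \<sigma> * (deriv ^^ N) J x"
      using assms(20) by (simp add: f_def)
    show "\<beta>1 * \<bar>x - xs\<bar>\<^sup>2 \<le> (deriv ^^ N) J x * (x - xs)" "\<bar>(deriv ^^ N) J x\<bar> \<le> \<beta>2 * \<bar>x - xs\<bar>"
      using assms(14,15) \<open>x \<in> D\<close> unfolding \<open>N = m - 1\<close> by blast+
  qed (use rho in simp)
  then obtain \<eta>1 where "\<eta>1 > 0"
    and \<eta>1: "\<And>\<eta> x0. 0 < \<eta> \<Longrightarrow> \<eta> \<le> \<eta>1 \<Longrightarrow> \<bar>x0 - xs\<bar> < \<delta> \<Longrightarrow> decays \<eta> x0" by blast
  have sol: "\<exists>x. is_global_solution D (F \<epsilon>) x0 x \<and>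
      (\<forall>t\<ge>0. \<bar>x t - xs\<bar> \<le> exp (\<sigma> * \<beta>1 * \<epsilon>) * \<bar>x0 - xs\<bar> * exp (- \<gamma> * t) + \<rho>)"
    if eps: "0 < \<epsilon>" "\<epsilon> \<le> \<eta>1 ^ Suc N" and gam: "\<gamma> \<le> \<gamma>bar" and x0: "x0 \<in> ball xs \<delta>" for \<epsilon> \<gamma> x0
  proof -
    \<comment> \<open>With \<open>\<eta> ^ Suc N = \<epsilon>\<close>, the decay
      \<open>\<sigma> * \<beta>1 * \<eta> ^ Suc N\<close> per unit of rescaled time becomes the rate
      \<open>\<sigma> * \<beta>1\<close> in the original time.\<close>
    define \<eta> where "\<eta> = \<epsilon> powr (1 / (real N + 1))"
    have "0 < \<eta>" using eps by (simp add: \<eta>_def)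
    have \<eta>N: "\<eta> ^ Suc N = \<epsilon>"
    proof -
      have "\<eta> ^ Suc N = \<eta> powr (real N + 1)"
        using powr_realpow[OF \<open>0 < \<eta>\<close>, of "Suc N"] by (simp add: add.commute)
      then show ?thesis using eps by (simp add: \<eta>_def powr_powr)
    qed
    have "\<eta> \<le> \<eta>1"
      using eps(2) \<open>0 < \<eta>\<close> \<open>\<eta>1 > 0\<close> unfolding \<eta>N[symmetric] by (meson less_imp_le power_le_imp_le_base)
    \<comment> \<open>The factor produced by the time change is exactly the amplitude scaling of the
      dithers.\<close>
    have scale: "\<eta> / \<epsilon> = \<epsilon> powr (- (real N / (real N + 1)))"
    proof -
      have "\<eta> / \<epsilon> = \<epsilon> powr (1 / (real N + 1) - 1)"
        using eps by (simp add: \<eta>_def powr_diff)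
      also have "1 / (real N + 1) - 1 = - (real N / (real N + 1))"
        by (simp add: field_simps)
      finally show ?thesis .
    qed
    have "\<bar>x0 - xs\<bar> < \<delta>" using x0 by (simp add: dist_real_def abs_minus_commute)
    from \<eta>1[OF \<open>0 < \<eta>\<close> \<open>\<eta> \<le> \<eta>1\<close> this] obtain X where "X 0 = x0"
      and X: "\<And>t. 0 \<le> t \<Longrightarrow> X t \<in> {xs - \<delta>'..xs + \<delta>'}"
        "\<And>t. 0 \<le> t \<Longrightarrow> (X has_real_derivative \<eta> * (\<Sum>i\<in>UNIV. f i (X t) * v i t)) (at t within {0..})"
        "\<And>t. 0 \<le> t \<Longrightarrow> \<bar>X t - xs\<bar> \<le> exp (\<sigma> * \<beta>1 * \<epsilon>) * exp (- (\<sigma> * \<beta>1 * \<epsilon> * t)) * \<bar>x0 - xs\<bar> + \<rho>"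
      unfolding decays_def \<eta>N by blast
    define x where "x t = X (t / \<epsilon>)" for t
    have F_eq: "F \<epsilon> t y = \<eta> / \<epsilon> * (\<Sum>i\<in>UNIV. f i y * v i (t / \<epsilon>))" for t y
      using \<open>odd N\<close> unfolding scale
      by (simp add: F_def f_def v_def dither1_def dither2_def UNIV_bool algebra_simps)
    have dx: "(x has_real_derivative F \<epsilon> t (x t)) (at t within {0..})" if "0 \<le> t" for t
    proof -
      have "(\<lambda>t. t / \<epsilon>) ` {0..} \<subseteq> {0..}" using eps by auto
      then have "(X has_real_derivative \<eta> * (\<Sum>i\<in>UNIV. f i (X (t / \<epsilon>)) * v i (t / \<epsilon>)))
          (at (t / \<epsilon>) within (\<lambda>t. t / \<epsilon>) ` {0..})"
        using that eps by (intro has_field_derivative_subset[OF X(2)]) auto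
      moreover have "((\<lambda>t. t / \<epsilon>) has_real_derivative 1 / \<epsilon>) (at t within {0..})"
        using eps by (auto intro!: derivative_eq_intros)
      ultimately have "(X \<circ> (\<lambda>t. t / \<epsilon>) has_real_derivative
          \<eta> * (\<Sum>i\<in>UNIV. f i (X (t / \<epsilon>)) * v i (t / \<epsilon>)) * (1 / \<epsilon>)) (at t within {0..})"
        by (rule DERIV_image_chain)
      then show ?thesis unfolding F_eq x_def o_def by simp
    qed
    have xD: "x t \<in> D" if "0 \<le> t" for t
      using X(1)[of "t / \<epsilon>"] that eps sub unfolding x_def by auto
    have unique: "y t = x t"
      if y: "ode_solution_on D (F \<epsilon>) {0..<T} y" "y 0 = x0" and t: "t \<in> {0..<T}" for T y t
    proof -
      have yD: "y s \<in> D" and dy: "(y has_real_derivative F \<epsilon> s (y s)) (at s within {0..t})"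
        if "s \<in> {0..t}" for s
      proof -
        have "s \<in> {0..<T}" "{0..t} \<subseteq> {0..<T}" using that t by auto
        with y(1) show "y s \<in> D" "(y has_real_derivative F \<epsilon> s (y s)) (at s within {0..t})"
          unfolding ode_solution_on_def by (blast intro: has_field_derivative_subset)+
      qed
      have dx': "(x has_real_derivative F \<epsilon> s (x s)) (at s within {0..t})" if "s \<in> {0..t}" for s
        using that by (intro has_field_derivative_subset[OF dx]) auto
      \<comment> \<open>A competing solution is only known to lie in \<open>D\<close>. The joint
        range of both solutions is compact, and connectedness of \<open>D\<close> places the
        interval it spans inside \<open>D\<close>, where Lipschitz bounds are available.\<close>
      define Q where "Q = x ` {0..t} \<union> y ` {0..t}"
      have "compact Q"
        unfolding Q_def using DERIV_continuous_on[OF dx'] DERIV_continuous_on[OF dy]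
        by (intro compact_Un compact_continuous_image compact_Icc) blast+
      moreover have "Q \<noteq> {}" using t by (auto simp: Q_def)
      ultimately obtain p q where pq: "p \<in> Q" "q \<in> Q" "\<And>z. z \<in> Q \<Longrightarrow> p \<le> z \<and> z \<le> q"
        by (metis compact_attains_inf compact_attains_sup)
      have "Q \<subseteq> D" using xD yD by (auto simp: Q_def)
      then have pqD: "{p..q} \<subseteq> D"
        using pq \<open>connected D\<close> by (intro connected_contains_Icc) auto
      have fC1: "C_on 1 (f i) D" for i using fC by (rule C_on_mono) auto
      obtain L1 L2 where "L1 \<ge> 0" "L2 \<ge> 0"
        and L12: "\<And>x y. x \<in> {p..q} \<Longrightarrow> y \<in> {p..q} \<Longrightarrow> \<bar>f True x - f True y\<bar> \<le> L1 * \<bar>x - y\<bar>"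
          "\<And>x y. x \<in> {p..q} \<Longrightarrow> y \<in> {p..q} \<Longrightarrow> \<bar>f False x - f False y\<bar> \<le> L2 * \<bar>x - y\<bar>"
        using C_on_1_lipschitz[OF fC1 pqD] by metis
      define Vb where "Vb = \<bar>c1\<bar> + \<bar>c2\<bar>"
      have lip: "\<bar>F \<epsilon> s u - F \<epsilon> s w\<bar> \<le> \<eta> / \<epsilon> * (L1 * Vb + L2 * Vb) * \<bar>u - w\<bar>"
        if "u \<in> {p..q}" "w \<in> {p..q}" for s u w
      proof -
        have vb: "\<bar>v i r\<bar> \<le> Vb" for i r
          unfolding v_def Vb_def by (rule sinusoid_bound)
        have "\<bar>(f True u - f True w) * v True (s / \<epsilon>)\<bar> \<le> (L1 * \<bar>u - w\<bar>) * Vb"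
          "\<bar>(f False u - f False w) * v False (s / \<epsilon>)\<bar> \<le> (L2 * \<bar>u - w\<bar>) * Vb"
          unfolding abs_mult using L12 that vb \<open>L1 \<ge> 0\<close> \<open>L2 \<ge> 0\<close> by (auto intro!: mult_mono)
        then have "\<bar>(f True u - f True w) * v True (s / \<epsilon>) + (f False u - f False w) * v False (s / \<epsilon>)\<bar>
            \<le> (L1 * \<bar>u - w\<bar>) * Vb + (L2 * \<bar>u - w\<bar>) * Vb"
          by (rule order_trans[OF abs_triangle_ineq add_mono])
        then have le: "\<eta> / \<epsilon> * \<bar>(f True u - f True w) * v True (s / \<epsilon>) + (f False u - f False w) * v False (s / \<epsilon>)\<bar>
            \<le> \<eta> / \<epsilon> * ((L1 * \<bar>u - w\<bar>) * Vb + (L2 * \<bar>u - w\<bar>) * Vb)"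
          using \<open>0 < \<eta>\<close> eps by (intro mult_left_mono) auto
        have "F \<epsilon> s u - F \<epsilon> s w = \<eta> / \<epsilon> *
            ((f True u - f True w) * v True (s / \<epsilon>) + (f False u - f False w) * v False (s / \<epsilon>))"
          unfolding F_eq UNIV_bool by (simp add: algebra_simps)
        then have "\<bar>F \<epsilon> s u - F \<epsilon> s w\<bar> = \<eta> / \<epsilon> *
            \<bar>(f True u - f True w) * v True (s / \<epsilon>) + (f False u - f False w) * v False (s / \<epsilon>)\<bar>"
          using \<open>0 < \<eta>\<close> eps(1) by (simp only: abs_mult abs_of_pos divide_pos_pos)
        also note le
        also have "\<eta> / \<epsilon> * ((L1 * \<bar>u - w\<bar>) * Vb + (L2 * \<bar>u - w\<bar>) * Vb) =
            \<eta> / \<epsilon> * (L1 * Vb + L2 * Vb) * \<bar>u - w\<bar>"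
          by (simp add: algebra_simps)
        finally show ?thesis .
      qed
      have "x t = y t"
      proof (rule ode_unique[where x=x and y=y and t=t and F="F \<epsilon>" and K="{p..q}"])
        show "0 \<le> t" using t by simp
        show "x 0 = y 0" using \<open>X 0 = x0\<close> y(2) by (simp add: x_def)
        show "x s \<in> {p..q} \<and> (x has_real_derivative F \<epsilon> s (x s)) (at s within {0..t})" if "s \<in> {0..t}" for s
          using pq(3)[of "x s"] dx'[OF that] that by (auto simp: Q_def)
        show "y s \<in> {p..q} \<and> (y has_real_derivative F \<epsilon> s (y s)) (at s within {0..t})" if "s \<in> {0..t}" for s
          using pq(3)[of "y s"] dy[OF that] that by (auto simp: Q_def)
      qed (rule lip)
      then show ?thesis by simp
    qed
    have "is_global_solution D (F \<epsilon>) x0 x"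
      unfolding is_global_solution_def
    proof (intro conjI allI impI ballI)
      show "ode_solution_on D (F \<epsilon>) {0..} x"
        using xD dx by (simp add: ode_solution_on_def)
      show "x 0 = x0" using \<open>X 0 = x0\<close> by (simp add: x_def)
    qed (use unique in blast)
    moreover have "\<bar>x t - xs\<bar> \<le> exp (\<sigma> * \<beta>1 * \<epsilon>) * \<bar>x0 - xs\<bar> * exp (- \<gamma> * t) + \<rho>" if "0 \<le> t" for t
    proof -
      have "\<gamma> * t \<le> \<sigma> * \<beta>1 * t" using gam gbar that by (intro mult_right_mono) auto
      then have "exp (- (\<sigma> * \<beta>1 * t)) \<le> exp (- \<gamma> * t)" by simp
      then have "exp (\<sigma> * \<beta>1 * \<epsilon>) * \<bar>x0 - xs\<bar> * exp (- (\<sigma> * \<beta>1 * t)) \<le>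
          exp (\<sigma> * \<beta>1 * \<epsilon>) * \<bar>x0 - xs\<bar> * exp (- \<gamma> * t)"
        by (intro mult_left_mono) auto
      moreover have "\<bar>x t - xs\<bar> \<le> exp (\<sigma> * \<beta>1 * \<epsilon>) * \<bar>x0 - xs\<bar> * exp (- (\<sigma> * \<beta>1 * t)) + \<rho>"
        using X(3)[of "t / \<epsilon>"] that eps by (simp add: x_def mult_ac)
      ultimately show ?thesis by linarith
    qed
    ultimately show ?thesis by blast
  qed
  show "\<exists>\<epsilon>bar>0. \<forall>\<epsilon>\<in>{0<..\<epsilon>bar}. \<forall>\<gamma>\<in>{0<..\<gamma>bar}.
        \<exists>lam>0. \<forall>x0\<in>ball xs \<delta>.
          \<exists>x. is_global_solution D
                (\<lambda>t y. g1 (J y) * dither1 N \<kappa> c1 \<epsilon> t + g2 (J y) * dither2 N \<kappa> c2 \<epsilon> t) x0 x \<and>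
              (\<forall>t\<ge>0. \<bar>x t - xs\<bar> \<le> lam * \<bar>x0 - xs\<bar> * exp (- \<gamma> * t) + \<rho>)"
    unfolding F_def[symmetric]
  proof (rule exI[of _ "\<eta>1 ^ Suc N"], intro conjI ballI)
    \<comment> \<open>The witness for \<open>lam\<close> is the loss over one period; it depends on
      \<open>\<epsilon>\<close> but neither on \<open>\<gamma>\<close> nor on
      \<open>x0\<close>.\<close>
    fix \<epsilon> \<gamma> assume "\<epsilon> \<in> {0<..\<eta>1 ^ Suc N}" "\<gamma> \<in> {0<..\<gamma>bar}"
    then show "\<exists>lam>0. \<forall>x0\<in>ball xs \<delta>. \<exists>x. is_global_solution D (F \<epsilon>) x0 x \<and>
        (\<forall>t\<ge>0. \<bar>x t - xs\<bar> \<le> lam * \<bar>x0 - xs\<bar> * exp (- \<gamma> * t) + \<rho>)"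
      using sol by (intro exI[of _ "exp (\<sigma> * \<beta>1 * \<epsilon>)"]) auto
  qed (use \<open>\<eta>1 > 0\<close> in simp)
qed

end
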